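(* Let $T\ge 0$ and $J\ge1$ be integers, and let $X_t(\theta)=\Gamma(\theta)+N_t(\theta)$, $\theta\in[-\pi,\pi]$, $t=0,\dots,T$, be the perfectly aligned noisy curve model described in the context. Let $$\hat\Gamma(\theta)=\hat\mu_0+\sum_{j=1}^J\left[\hat\mu_j\cos(j\theta)+\hat\nu_j\sin(j\theta)\right],\quad\theta\in[-\pi,\pi],$$ where $\hat\mu_j=\frac1{T+1}\sum_{t=0}^TF_j^t$ and $\hat\nu_j=\frac1{T+1}\sum_{t=0}^TG_j^t$ are the averages of the Fourier coefficients of the $X_t$. Then $\hat\Gamma$ is a (covariance-)stationary cyclic Gaussian process with independent components. Its mean vector at $\theta$ is $$\mu_0+\sum_{j=1}^J\left[\mu_j\cos(j\theta)+\nu_j\sin(j\theta)\right],$$ the Fourier representation of $\Gamma$ truncated at $J$. The covariance function of both components of $\hat\Gamma$ is $\rho_J(\theta)/(T+1)$, where $\rho_J(\theta)=\sum_{j=0}^J\sigma_j^2\cos(j\theta)$; that is, $\mathrm{Cov}(\hat\Gamma_i(\theta),\hat\Gamma_i(\eta))=\rho_J(\eta-\theta)/(T+1)$ for $i=1,2$. The integrated squared error can be written as $$\frac1\pi\int_{-\pi}^\pi\|\hat\Gamma(\theta)-\Gamma(\theta)\|^2\,d\theta=\sum_{j=J+1}^\infty\left[\|\mu_j\|^2+\|\nu_j\|^2\right]+Z_J,\qquad Z_J=\frac{1}{T+1}\Big(2\sigma_0^2Z_0+\sum_{j=1}^J\sigma_j^2\,Z_{(j)}\Big),$$ where $Z_0,Z_{(1)},\dots,Z_{(J)}$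 are independent $\chi^2$ distributed random variables, with four degrees of freedom for $Z_{(j)}$, $j\ge1$, and two degrees of freedom for $Z_0$.
   Context: Model. $\Gamma=(\Gamma_1,\Gamma_2):[-\pi,\pi]\to\mathbb{R}^2$ is a $C^1$ function with $\Gamma(-\pi)=\Gamma(\pi)$. Its Fourier coefficients are $\mu_0=\frac1{2\pi}\int_{-\pi}^\pi\Gamma(\theta)\,d\theta$, $\mu_j=\frac1\pi\int_{-\pi}^\pi\Gamma(\theta)\cos(j\theta)\,d\theta$, $\nu_j=\frac1\pi\int_{-\pi}^\pi\Gamma(\theta)\sin(j\theta)\,d\theta$, $j\in\mathbb{N}=\{1,2,\dots\}$ (componentwise). Noise. The processes $N_t=(N_{t,1},N_{t,2})$ are independent over $t$, with $N_{t,i}(\theta)=\sum_{j=0}^\infty[A_{j,i}^t\cos(j\theta)+B_{j,i}^t\sin(j\theta)]$, $i=1,2$, where all $A_{j,i}^t,B_{j,i}^t$ are mutually independent zero-mean Gaussian random variables, $A^t_{j,i}$ and $B^t_{j,i}$ having variance $\sigma_j^2$, and for some $\epsilon>0$, $\sum_{j\ge1}j^{2+\epsilon}\sigma_j^2<\infty$. The $N_{t,i}$ are taken in their continuously differentiable version. Random Fourier coefficients: $F_0^t=\frac1{2\pi}\int_{-\pi}^\pi X_t(\theta)\,d\theta=\mu_0+A_0^t$, and for $j\in\mathbb{N}$, $F_j^t=\frac1\pi\int_{-\pi}^\pi X_t(\theta)\cos(j\theta)\,d\theta=\mu_j+A_j^t$, $G_j^t=\frac1\pi\int_{-\pi}^\pi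 X_t(\theta)\sin(j\theta)\,d\theta=\nu_j+B_j^t$, with $A_j^t=(A_{j,1}^t,A_{j,2}^t)$, $B_j^t=(B_{j,1}^t,B_{j,2}^t)$. Conventions. "Stationary" for a process with non-constant mean means that the covariance between the values at $\theta$ and $\eta$ depends only on $\eta-\theta$. If some $\sigma_j^2=0$, the corresponding $\chi^2$ variable enters with coefficient zero and may be chosen arbitrarily with the stated law (on an enlarged probability space if necessary). $\|\cdot\|$ is the Euclidean norm. *)

theory Defs
  imports "HOL-Probability.Probability"
begin

section \<open>Curves and Fourier coefficients\<close>

text \<open>Derivatives are one-sided at the end points; nothing is required of \<open>f\<close> outside the
  interval, and the derivatives at the two end points need not agree.\<close>

definition C1_curve :: "(real \<Rightarrow> 'a::real_normed_vector) \<Rightarrow> bool" where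
  "C1_curve f \<longleftrightarrow>
     (\<exists>f'. continuous_on {-pi..pi} f' \<and>
           (\<forall>\<theta>\<in>{-pi..pi}. (f has_vector_derivative f' \<theta>) (at \<theta> within {-pi..pi})))"

definition fourier_cos :: "(real \<Rightarrow> 'a::euclidean_space) \<Rightarrow> nat \<Rightarrow> 'a" where
  "fourier_cos f j =
     (if j = 0 then 1 / (2 * pi) else 1 / pi) *\<^sub>R
       integral {-pi..pi} (\<lambda>\<theta>. cos (real j * \<theta>) *\<^sub>R f \<theta>)"

definition fourier_sin :: "(real \<Rightarrow> 'a::euclidean_space) \<Rightarrow> nat \<Rightarrow> 'a" where
  "fourier_sin f j =
     (1 / pi) *\<^sub>R integral {-pi..pi} (\<lambda>\<theta>. sin (real j * \<theta>) *\<^sub>R f \<theta>)"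

definition trig_poly ::
    "nat \<Rightarrow> (nat \<Rightarrow> 'a::real_vector) \<Rightarrow> (nat \<Rightarrow> 'a) \<Rightarrow> real \<Rightarrow> 'a" where
  "trig_poly J a b \<theta> =
     a 0 + (\<Sum>j = 1..J. cos (real j * \<theta>) *\<^sub>R a j + sin (real j * \<theta>) *\<^sub>R b j)"

section \<open>Random variables and processes\<close>

text \<open>Gaussian with mean \<open>m\<close> and variance \<open>v\<close>; the degenerate case \<open>v = 0\<close> is included,
  which \<open>normal_density\<close> does not cover.\<close>

definition gaussian_rv :: "'w measure \<Rightarrow> real \<Rightarrow> real \<Rightarrow> ('w \<Rightarrow> real) \<Rightarrow> bool" where
  "gaussian_rv M m v X \<longleftrightarrow>
     X \<in> borel_measurable M \<and>
     (v = 0 \<and> (AE \<omega> in M. X \<omega> = m) \<or>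
      v > 0 \<and> distributed M lborel X (normal_density m (sqrt v)))"

definition chi_square :: "nat \<Rightarrow> real measure" where
  "chi_square k =
     distr (PiM {..<k} (\<lambda>_. std_normal_distribution)) borel (\<lambda>x. \<Sum>i<k. (x i)\<^sup>2)"

definition covariance :: "'w measure \<Rightarrow> ('w \<Rightarrow> real) \<Rightarrow> ('w \<Rightarrow> real) \<Rightarrow> real" where
  "covariance M X Y =
     (LINT \<omega>|M. (X \<omega> - (LINT \<omega>'|M. X \<omega>')) * (Y \<omega> - (LINT \<omega>'|M. Y \<omega>')))"

text \<open>Processes with values in \<open>real ^ 'n\<close> and time parameter in \<open>I\<close>.\<close>

definition gaussian_process ::
    "'w measure \<Rightarrow> real set \<Rightarrow> (real \<Rightarrow> 'w \<Rightarrow> real ^ 'n) \<Rightarrow> bool" where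
  "gaussian_process M I Y \<longleftrightarrow>
     (\<forall>\<theta>\<in>I. Y \<theta> \<in> borel_measurable M) \<and>
     (\<forall>S c. finite S \<and> S \<subseteq> I \<longrightarrow>
        (\<exists>m v. gaussian_rv M m v (\<lambda>\<omega>. \<Sum>\<theta>\<in>S. c \<theta> \<bullet> Y \<theta> \<omega>)))"

text \<open>The mean need not be constant.\<close>

definition covariance_stationary ::
    "'w measure \<Rightarrow> real set \<Rightarrow> (real \<Rightarrow> 'w \<Rightarrow> real ^ 'n) \<Rightarrow> bool" where
  "covariance_stationary M I Y \<longleftrightarrow>
     (\<exists>R. \<forall>\<theta>\<in>I. \<forall>\<eta>\<in>I. \<forall>i k.
        covariance M (\<lambda>\<omega>. Y \<theta> \<omega> $ i) (\<lambda>\<omega>. Y \<eta> \<omega> $ k) = R i k (\<eta> - \<theta>))"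

definition cyclic_process :: "'w measure \<Rightarrow> (real \<Rightarrow> 'w \<Rightarrow> 'a) \<Rightarrow> bool" where
  "cyclic_process M Y \<longleftrightarrow> (\<forall>\<omega>\<in>space M. Y (-pi) \<omega> = Y pi \<omega>)"

definition independent_components ::
    "'w measure \<Rightarrow> real set \<Rightarrow> (real \<Rightarrow> 'w \<Rightarrow> real ^ 'n) \<Rightarrow> bool" where
  "independent_components M I Y \<longleftrightarrow>
     prob_space.indep_vars M (\<lambda>_. PiM I (\<lambda>_. borel)) (\<lambda>i \<omega>. \<lambda>\<theta>\<in>I. Y \<theta> \<omega> $ i) UNIV"

section \<open>The noise model\<close>

text \<open>\<open>N t \<theta> \<omega>\<close> is the noise of curve \<open>t \<le> T\<close> at parameter \<open>\<theta>\<close>; \<open>A t j i\<close> and \<open>B t j i\<close> are the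
  random coefficients of its \<open>i\<close>-th component at frequency \<open>j\<close>. The series only determines
  \<open>N t \<theta>\<close> almost surely for each \<open>\<theta>\<close>; \<open>N\<close> is a version all of whose paths are \<open>C\<^sup>1\<close>.
  The term \<open>j = 0\<close> of the moment condition is zero because \<open>0 powr a = 0\<close>.\<close>

definition noise_model ::
    "'w measure \<Rightarrow> nat \<Rightarrow> (nat \<Rightarrow> real) \<Rightarrow> (nat \<Rightarrow> nat \<Rightarrow> 2 \<Rightarrow> 'w \<Rightarrow> real) \<Rightarrow>
     (nat \<Rightarrow> nat \<Rightarrow> 2 \<Rightarrow> 'w \<Rightarrow> real) \<Rightarrow> (nat \<Rightarrow> real \<Rightarrow> 'w \<Rightarrow> real ^ 2) \<Rightarrow> bool" where
  "noise_model M T \<sigma> A B N \<longleftrightarrow>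
     (\<exists>\<epsilon>>0. summable (\<lambda>j. real j powr (2 + \<epsilon>) * (\<sigma> j)\<^sup>2)) \<and>
     (\<forall>t\<le>T. \<forall>j i. gaussian_rv M 0 ((\<sigma> j)\<^sup>2) (A t j i) \<and> gaussian_rv M 0 ((\<sigma> j)\<^sup>2) (B t j i)) \<and>
     prob_space.indep_vars M (\<lambda>_. borel)
       (\<lambda>(is_cos, t, j, i). if is_cos then A t j i else B t j i)
       ((UNIV :: bool set) \<times> {..T} \<times> UNIV \<times> UNIV) \<and>
     (\<forall>t\<le>T. \<forall>\<theta>\<in>{-pi..pi}. N t \<theta> \<in> borel_measurable M) \<and>
     (\<forall>t\<le>T. \<forall>\<theta>\<in>{-pi..pi}. \<forall>i. AE \<omega> in M.
        (\<lambda>j. A t j i \<omega> * cos (real j * \<theta>) + B t j i \<omega> * sin (real j * \<theta>)) sums (N t \<theta> \<omega> $ i)) \<and>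
     (\<forall>t\<le>T. \<forall>\<omega>\<in>space M. C1_curve (\<lambda>\<theta>. N t \<theta> \<omega>)) \<and>
     prob_space.indep_vars M (\<lambda>_. PiM {-pi..pi} (\<lambda>_. borel))
       (\<lambda>t \<omega>. \<lambda>\<theta>\<in>{-pi..pi}. N t \<theta> \<omega>) {..T}"

section \<open>The estimator and its error\<close>

definition mu_hat ::
    "nat \<Rightarrow> (nat \<Rightarrow> real \<Rightarrow> 'w \<Rightarrow> real ^ 2) \<Rightarrow> nat \<Rightarrow> 'w \<Rightarrow> real ^ 2" where
  "mu_hat T X j \<omega> = (1 / real (T + 1)) *\<^sub>R (\<Sum>t\<le>T. fourier_cos (\<lambda>\<theta>. X t \<theta> \<omega>) j)"

definition nu_hat ::
    "nat \<Rightarrow> (nat \<Rightarrow> real \<Rightarrow> 'w \<Rightarrow> real ^ 2) \<Rightarrow> nat \<Rightarrow> 'w \<Rightarrow> real ^ 2" where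
  "nu_hat T X j \<omega> = (1 / real (T + 1)) *\<^sub>R (\<Sum>t\<le>T. fourier_sin (\<lambda>\<theta>. X t \<theta> \<omega>) j)"

definition Gamma_hat ::
    "nat \<Rightarrow> nat \<Rightarrow> (nat \<Rightarrow> real \<Rightarrow> 'w \<Rightarrow> real ^ 2) \<Rightarrow> real \<Rightarrow> 'w \<Rightarrow> real ^ 2" where
  "Gamma_hat T J X \<theta> \<omega> = trig_poly J (\<lambda>j. mu_hat T X j \<omega>) (\<lambda>j. nu_hat T X j \<omega>) \<theta>"

definition rho :: "(nat \<Rightarrow> real) \<Rightarrow> nat \<Rightarrow> real \<Rightarrow> real" where
  "rho \<sigma> J \<theta> = (\<Sum>j\<le>J. (\<sigma> j)\<^sup>2 * cos (real j * \<theta>))"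

definition integrated_squared_error ::
    "(real \<Rightarrow> real ^ 2) \<Rightarrow> (real \<Rightarrow> real ^ 2) \<Rightarrow> real" where
  "integrated_squared_error f g = (1 / pi) * integral {-pi..pi} (\<lambda>\<theta>. (norm (f \<theta> - g \<theta>))\<^sup>2)"

definition weighted_chi_square_sum ::
    "'w measure \<Rightarrow> nat \<Rightarrow> nat \<Rightarrow> (nat \<Rightarrow> real) \<Rightarrow> ('w \<Rightarrow> real) \<Rightarrow> bool" where
  "weighted_chi_square_sum M T J \<sigma> Y \<longleftrightarrow>
     (\<exists>Z. prob_space.indep_vars M (\<lambda>_. borel) Z {..J} \<and>
          distr M borel (Z 0) = chi_square 2 \<and>
          (\<forall>j\<in>{1..J}. distr M borel (Z j) = chi_square 4) \<and>
          (\<forall>\<omega>\<in>space M. Y \<omega> =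
             1 / real (T + 1) * (2 * (\<sigma> 0)\<^sup>2 * Z 0 \<omega> + (\<Sum>j = 1..J. (\<sigma> j)\<^sup>2 * Z j \<omega>))))"

end

theory Submission
  imports Defs
begin

text \<open>The estimator is a trigonometric polynomial of degree \<open>J\<close> whose coefficients are the averaged
  Fourier coefficients of the observed curves, so every claim reduces to the joint law of finitely
  many real random variables. That law is as simple as possible: the coordinates of the coefficients
  are independent Gaussians, centred at the Fourier coefficients of \<open>\<Gamma>\<close>, with variance
  \<open>\<sigma>\<^sub>j\<^sup>2 / (T + 1)\<close> at frequency \<open>j\<close> (\<open>mean_fcoef_independent_gaussian\<close>). Given this,
  Gaussianity holds because a linear combination of independent Gaussians is Gaussian; the
  covariance is \<open>\<rho>\<^sub>J(\<eta> - \<theta>) / (T + 1)\<close> because the cosine and the sine coefficient at one frequency have the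
  same variance, so that the addition theorem for the cosine applies; the two components are
  independent because they are functions of disjoint groups of coefficients.

  The point that needs care is that the noise curve is tied to its random series only almost surely
  and separately at each \<open>\<theta>\<close>. The moment condition forces the coefficients to be absolutely summable
  almost surely; the series then converges uniformly to a continuous function, which agrees with
  the continuous noise path on a countable dense set and therefore everywhere. Integrating term by
  term identifies the Fourier coefficients of the path (\<open>AE_fcoef_noise\<close>). They are measurable
  functions of the outcome because a process with continuous paths is jointly measurable
  (\<open>borel_measurable_fcoef\<close>), and measurability is what allows laws and independence to be carried
  along almost sure equalities.

  The error formula is Parseval's identity (\<open>parseval\<close>) for the difference between the estimator and \<open>\<Gamma>\<close>: beyond frequency \<open>J\<close> its
  coefficients are those of \<open>-\<Gamma>\<close>, and up to \<open>J\<close> they are the centred Gaussian coefficients, whose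
  squares group into \<open>\<chi>\<^sup>2\<close> variables with two coordinates at frequency \<open>0\<close> and four at each
  \<open>j \<ge> 1\<close>. Parseval's identity rests on the density of trigonometric polynomials, an instance of the
  Stone--Weierstrass theorem on the unit circle. Where \<open>\<sigma>\<^sub>j = 0\<close> a coefficient cannot be standardized,
  and the missing standard Gaussians are read off a second factor of the probability space
  (\<open>standard_gaussian_extension\<close>).\<close>

section \<open>Modes and Fourier coefficients\<close>

text \<open>Cosines and sines form one family, so that orthogonality, Parseval's identity and the independence of
  the coefficients are each treated once instead of separately for the two.\<close>

definition mode :: "bool \<times> nat \<Rightarrow> real \<Rightarrow> real" where
  "mode m \<theta> = (if fst m then cos (real (snd m) * \<theta>) else sin (real (snd m) * \<theta>))"

text \<open>The pair \<open>(False, 0)\<close> is left out because its mode is the zero function; the remaining modes form an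
  orthogonal system.\<close>

definition modes :: "nat \<Rightarrow> (bool \<times> nat) set" where
  "modes J = insert (True, 0) (UNIV \<times> {1..J})"

text \<open>\<open>\<pi>\<close> times the weight is the squared \<open>L\<^sup>2\<close> norm on \<open>[-\<pi>, \<pi>]\<close> of a mode other than \<open>(False, 0)\<close>.\<close>

definition mode_weight :: "bool \<times> nat \<Rightarrow> real" where
  "mode_weight m = (if snd m = 0 then 2 else 1)"

definition fcoef :: "(real \<Rightarrow> 'a::euclidean_space) \<Rightarrow> bool \<times> nat \<Rightarrow> 'a" where
  "fcoef f m = (if fst m then fourier_cos f (snd m) else fourier_sin f (snd m))"

lemma finite_modes [simp]: "finite (modes J)"
  by (simp add: modes_def)

lemma mode_weight_pos [simp]: "0 < mode_weight m"
  by (simp add: mode_weight_def)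

lemma modes_mono: "J \<le> K \<Longrightarrow> modes J \<subseteq> modes K"
  by (auto simp: modes_def)

lemma mem_modes_iff: "m \<in> modes J \<longleftrightarrow> snd m \<le> J \<and> (fst m \<or> 1 \<le> snd m)"
  by (cases m) (auto simp: modes_def)

lemma sum_modes:
  fixes g :: "bool \<times> nat \<Rightarrow> 'a::comm_monoid_add"
  shows "sum g (modes J) = g (True, 0) + (\<Sum>j = 1..J. g (True, j) + g (False, j))"
proof -
  have "sum g (UNIV \<times> {1..J}) = (\<Sum>j = 1..J. g (True, j) + g (False, j))"
    using sum.cartesian_product[of "\<lambda>b j. g (b, j)" "{1..J}" UNIV]
    by (simp add: UNIV_bool sum.distrib add.commute)
  thus ?thesis
    unfolding modes_def by (subst sum.insert) auto
qed

lemma continuous_on_mode [continuous_intros]: "continuous_on S (mode m)"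
  unfolding mode_def by (cases "fst m") (auto intro!: continuous_intros)

lemma abs_mode_le_1: "\<bar>mode m \<theta>\<bar> \<le> 1"
  by (simp add: mode_def)

lemma mode_periodic: "mode m (-pi) = mode m pi"
  by (simp add: mode_def)

lemma trig_poly_eq_sum_modes:
  "trig_poly J a b \<theta> = (\<Sum>m\<in>modes J. mode m \<theta> *\<^sub>R (if fst m then a (snd m) else b (snd m)))"
  unfolding trig_poly_def sum_modes by (simp add: mode_def)

lemma trig_poly_fourier:
  "trig_poly J (fourier_cos f) (fourier_sin f) \<theta> = (\<Sum>m\<in>modes J. mode m \<theta> *\<^sub>R fcoef f m)"
  unfolding trig_poly_eq_sum_modes fcoef_def by simp

text \<open>Integer frequencies are used for products of modes because the product-to-sum formulas produce the
  frequency \<open>j - k\<close>, which may be negative.\<close>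

lemma has_integral_cos_int:
  "((\<lambda>\<theta>. cos (of_int k * \<theta>)) has_integral (if k = 0 then 2 * pi else 0)) {-pi..pi}"
proof (cases "k = 0")
  case True
  then show ?thesis using has_integral_const_real[of "1::real" "-pi" pi] by simp
next
  case False
  have "((\<lambda>\<theta>. cos (of_int k * \<theta>)) has_integral
          (sin (of_int k * pi) / of_int k - sin (of_int k * (-pi)) / of_int k)) {-pi..pi}"
    using False
    by (intro fundamental_theorem_of_calculus)
       (auto intro!: derivative_eq_intros simp: has_real_derivative_iff_has_vector_derivative[symmetric])
  then show ?thesis using False sin_zero_iff_int2 by (auto simp: mult.commute)
qed

lemma has_integral_sin_int:
  "((\<lambda>\<theta>. sin (of_int k * \<theta>)) has_integral 0) {-pi..pi}"
proof (cases "k = 0")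
  case True
  then show ?thesis by simp
next
  case False
  have "((\<lambda>\<theta>. sin (of_int k * \<theta>)) has_integral
          (- cos (of_int k * pi) / of_int k - - cos (of_int k * (-pi)) / of_int k)) {-pi..pi}"
    using False
    by (intro fundamental_theorem_of_calculus)
       (auto intro!: derivative_eq_intros simp: has_real_derivative_iff_has_vector_derivative[symmetric])
  then show ?thesis by simp
qed

lemma cos_mult_cos_nat:
  "cos (real j * \<theta>) * cos (real k * \<theta>) =
     (cos (of_int (int j - int k) * \<theta>) + cos (of_int (int j + int k) * \<theta>)) / 2"
  by (simp add: cos_times_cos algebra_simps)

lemma sin_mult_sin_nat:
  "sin (real j * \<theta>) * sin (real k * \<theta>) =
     (cos (of_int (int j - int k) * \<theta>) - cos (of_int (int j + int k) * \<theta>)) / 2"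
  by (simp add: sin_times_sin algebra_simps)

lemma sin_mult_cos_nat:
  "sin (real j * \<theta>) * cos (real k * \<theta>) =
     (sin (of_int (int j + int k) * \<theta>) + sin (of_int (int j - int k) * \<theta>)) / 2"
  by (simp add: sin_times_cos left_diff_distrib distrib_right)

text \<open>The second mode ranges over all pairs, so that the vanishing mode \<open>(False, 0)\<close> is covered: this is
  what a series of cosine and sine terms starting at frequency \<open>0\<close> contains.\<close>

lemma mode_orthogonal:
  assumes "m \<in> modes J"
  shows "((\<lambda>\<theta>. mode m \<theta> * mode m' \<theta>) has_integral (if m = m' then pi * mode_weight m else 0)) {-pi..pi}"
proof -
  obtain b j where m: "m = (b, j)" by (cases m)
  obtain c k where m': "m' = (c, k)" by (cases m')
  let ?I = "\<lambda>z::int. if z = 0 then 2 * pi else 0"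
  have cc: "((\<lambda>\<theta>. cos (real j * \<theta>) * cos (real k * \<theta>)) has_integral
              (?I (int j - int k) + ?I (int j + int k)) / 2) {-pi..pi}"
    unfolding cos_mult_cos_nat
    by (intro has_integral_divide has_integral_add has_integral_cos_int)
  have ss: "((\<lambda>\<theta>. sin (real j * \<theta>) * sin (real k * \<theta>)) has_integral
              (?I (int j - int k) - ?I (int j + int k)) / 2) {-pi..pi}"
    unfolding sin_mult_sin_nat
    by (intro has_integral_divide has_integral_diff has_integral_cos_int)
  have sc: "((\<lambda>\<theta>. sin (real j * \<theta>) * cos (real k * \<theta>)) has_integral (0 + 0) / 2) {-pi..pi}" for j k
    unfolding sin_mult_cos_nat
    by (intro has_integral_divide has_integral_add has_integral_sin_int)
  have cs: "((\<lambda>\<theta>. cos (real j * \<theta>) * sin (real k * \<theta>)) has_integral (0 + 0) / 2) {-pi..pi}"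
    using sc[of k j] by (simp add: mult.commute)
  show ?thesis
  proof (cases b; cases c)
    assume "b" "c"
    with cc show ?thesis by (auto simp: m m' mode_def mode_weight_def mult.commute)
  next
    assume "\<not> b" "\<not> c"
    with ss assms show ?thesis by (auto simp: m m' mode_def mode_weight_def mem_modes_iff)
  qed (use cs sc[of j k] in \<open>auto simp: m m' mode_def\<close>)
qed

lemma fcoef_eq_integral:
  assumes "m \<in> modes J"
  shows "fcoef f m = (1 / (pi * mode_weight m)) *\<^sub>R integral {-pi..pi} (\<lambda>\<theta>. mode m \<theta> *\<^sub>R f \<theta>)"
  using assms
  by (auto simp: fcoef_def fourier_cos_def fourier_sin_def mode_def mode_weight_def mem_modes_iff mult.commute)

lemma integrable_mode_scaleR:
  fixes f :: "real \<Rightarrow> 'a::euclidean_space"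
  assumes "continuous_on {-pi..pi} f"
  shows "(\<lambda>\<theta>. mode m \<theta> *\<^sub>R f \<theta>) integrable_on {-pi..pi}"
  by (intro integrable_continuous_real continuous_intros assms)

lemma fcoef_linear_image:
  fixes h :: "'a::euclidean_space \<Rightarrow> 'b::euclidean_space"
  assumes "bounded_linear h" "continuous_on {-pi..pi} f" "m \<in> modes J"
  shows "fcoef (\<lambda>\<theta>. h (f \<theta>)) m = h (fcoef f m)"
proof -
  interpret bounded_linear h by fact
  have "integral {-pi..pi} (h \<circ> (\<lambda>\<theta>. mode m \<theta> *\<^sub>R f \<theta>)) = h (integral {-pi..pi} (\<lambda>\<theta>. mode m \<theta> *\<^sub>R f \<theta>))"
    by (intro integral_linear integrable_mode_scaleR assms)
  thus ?thesis
    unfolding fcoef_eq_integral[OF assms(3)] by (simp add: o_def scaleR)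
qed

lemma fcoef_add:
  fixes f g :: "real \<Rightarrow> 'a::euclidean_space"
  assumes "continuous_on {-pi..pi} f" "continuous_on {-pi..pi} g" "m \<in> modes J"
  shows "fcoef (\<lambda>\<theta>. f \<theta> + g \<theta>) m = fcoef f m + fcoef g m"
  unfolding fcoef_eq_integral[OF assms(3)]
  by (simp add: scaleR_add_right integral_add integrable_mode_scaleR assms)

lemma fcoef_diff:
  fixes f g :: "real \<Rightarrow> 'a::euclidean_space"
  assumes "continuous_on {-pi..pi} f" "continuous_on {-pi..pi} g" "m \<in> modes J"
  shows "fcoef (\<lambda>\<theta>. f \<theta> - g \<theta>) m = fcoef f m - fcoef g m"
  unfolding fcoef_eq_integral[OF assms(3)]
  by (simp add: scaleR_diff_right integral_diff integrable_mode_scaleR assms)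

lemma fcoef_cong:
  assumes "\<And>\<theta>. \<theta> \<in> {-pi..pi} \<Longrightarrow> f \<theta> = g \<theta>"
  shows "fcoef f m = fcoef g m"
  unfolding fcoef_def fourier_cos_def fourier_sin_def
  by (auto intro!: arg_cong2[where f="(*\<^sub>R)"] integral_cong simp: assms)

lemma fcoef_trig_sum:
  fixes c :: "bool \<times> nat \<Rightarrow> 'a::euclidean_space"
  assumes "m \<in> modes K"
  shows "fcoef (\<lambda>\<theta>. \<Sum>n\<in>modes J. mode n \<theta> *\<^sub>R c n) m = (if m \<in> modes J then c m else 0)"
proof -
  have "((\<lambda>\<theta>. \<Sum>n\<in>modes J. (mode m \<theta> * mode n \<theta>) *\<^sub>R c n) has_integral
          (\<Sum>n\<in>modes J. (if m = n then pi * mode_weight m else 0) *\<^sub>R c n)) {-pi..pi}"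
    by (intro has_integral_sum has_integral_scaleR_left mode_orthogonal[OF assms]) auto
  also have "(\<Sum>n\<in>modes J. (if m = n then pi * mode_weight m else 0) *\<^sub>R c n) =
      (\<Sum>n\<in>modes J. if m = n then (pi * mode_weight m) *\<^sub>R c n else 0)"
    by (intro sum.cong) auto
  also have "\<dots> = (if m \<in> modes J then (pi * mode_weight m) *\<^sub>R c m else 0)"
    by (simp add: sum.delta')
  finally show ?thesis
    unfolding fcoef_eq_integral[OF assms]
    by (simp add: scaleR_sum_right integral_unique mode_weight_pos[THEN less_imp_neq, symmetric])
qed

text \<open>Pythagoras: the squared distance from \<open>f\<close> to a trigonometric polynomial of degree \<open>J\<close> splits into the
  distance to the Fourier polynomial of \<open>f\<close> and the distance between the two polynomials. With
  \<open>c = fcoef f\<close> it yields Bessel's inequality, and in general the best approximation property.\<close>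

lemma integral_square_diff_trig_sum:
  fixes f :: "real \<Rightarrow> real"
  assumes f: "continuous_on {-pi..pi} f"
  shows "integral {-pi..pi} (\<lambda>\<theta>. (f \<theta> - (\<Sum>m\<in>modes J. c m * mode m \<theta>))\<^sup>2) =
     integral {-pi..pi} (\<lambda>\<theta>. (f \<theta>)\<^sup>2) - pi * (\<Sum>m\<in>modes J. mode_weight m * (fcoef f m)\<^sup>2)
       + pi * (\<Sum>m\<in>modes J. mode_weight m * (fcoef f m - c m)\<^sup>2)"
proof -
  define p where "p \<theta> = (\<Sum>m\<in>modes J. c m * mode m \<theta>)" for \<theta>
  \<comment> \<open>The inner product of \<open>g\<close> with \<open>p\<close> depends only on the Fourier coefficients of \<open>g\<close>; it is used for \<open>g = f\<close> and \<open>g = p\<close>.\<close>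
  have inner: "integral {-pi..pi} (\<lambda>\<theta>. g \<theta> * p \<theta>) = pi * (\<Sum>m\<in>modes J. mode_weight m * c m * fcoef g m)"
    if g: "continuous_on {-pi..pi} g" for g :: "real \<Rightarrow> real"
  proof -
    have "integral {-pi..pi} (\<lambda>\<theta>. g \<theta> * p \<theta>) = integral {-pi..pi} (\<lambda>\<theta>. \<Sum>m\<in>modes J. c m * (mode m \<theta> *\<^sub>R g \<theta>))"
      by (simp add: p_def sum_distrib_left mult_ac)
    also have "\<dots> = (\<Sum>m\<in>modes J. c m * integral {-pi..pi} (\<lambda>\<theta>. mode m \<theta> *\<^sub>R g \<theta>))"
      by (subst integral_sum) (auto intro!: integrable_on_mult_right integrable_mode_scaleR[OF g, simplified])
    also have "\<dots> = (\<Sum>m\<in>modes J. pi * (mode_weight m * c m * fcoef g m))"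
      by (intro sum.cong refl) (simp add: fcoef_eq_integral field_simps mode_weight_pos[THEN less_imp_neq, symmetric])
    finally show ?thesis by (simp add: sum_distrib_left)
  qed
  have p: "continuous_on {-pi..pi} p"
    unfolding p_def by (intro continuous_intros)
  have fp: "fcoef p m = c m" if "m \<in> modes J" for m
    using fcoef_trig_sum[OF that, where c = c and J = J] that by (simp add: p_def[abs_def] mult.commute)
  have "integral {-pi..pi} (\<lambda>\<theta>. (f \<theta> - p \<theta>)\<^sup>2) =
        integral {-pi..pi} (\<lambda>\<theta>. (f \<theta>)\<^sup>2 - 2 * (f \<theta> * p \<theta>) + p \<theta> * p \<theta>)"
    by (intro integral_cong) (simp add: power2_eq_square algebra_simps)
  also have "\<dots> = integral {-pi..pi} (\<lambda>\<theta>. (f \<theta>)\<^sup>2) - 2 * integral {-pi..pi} (\<lambda>\<theta>. f \<theta> * p \<theta>)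
                  + integral {-pi..pi} (\<lambda>\<theta>. p \<theta> * p \<theta>)"
    by (subst integral_add integral_diff integral_mult_right;
        (intro integrable_continuous_real continuous_intros f p)?)+ simp
  also have "\<dots> = integral {-pi..pi} (\<lambda>\<theta>. (f \<theta>)\<^sup>2)
      - pi * (\<Sum>m\<in>modes J. mode_weight m * (2 * c m * fcoef f m - c m * c m))"
    by (simp add: inner f p fp algebra_simps sum_subtractf sum_distrib_left)
  also have "(\<Sum>m\<in>modes J. mode_weight m * (2 * c m * fcoef f m - c m * c m)) =
      (\<Sum>m\<in>modes J. mode_weight m * (fcoef f m)\<^sup>2) - (\<Sum>m\<in>modes J. mode_weight m * (fcoef f m - c m)\<^sup>2)"
    unfolding sum_subtractf[symmetric]
    by (intro sum.cong refl) (simp add: power2_eq_square algebra_simps)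
  finally show ?thesis by (simp add: p_def algebra_simps)
qed

section \<open>Density of trigonometric polynomials\<close>

definition is_trig_poly :: "(real \<Rightarrow> real) \<Rightarrow> bool" where
  "is_trig_poly p \<longleftrightarrow> (\<exists>J c. \<forall>\<theta>. p \<theta> = (\<Sum>m\<in>modes J. c m * mode m \<theta>))"

text \<open>The closure properties make the trigonometric polynomials an algebra of functions, as the
  Stone--Weierstrass theorem requires.\<close>

lemma is_trig_poly_add:
  assumes "is_trig_poly p" "is_trig_poly q"
  shows "is_trig_poly (\<lambda>\<theta>. p \<theta> + q \<theta>)"
proof -
  obtain J c K d where p: "\<And>\<theta>. p \<theta> = (\<Sum>m\<in>modes J. c m * mode m \<theta>)"
    and q: "\<And>\<theta>. q \<theta> = (\<Sum>m\<in>modes K. d m * mode m \<theta>)"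
    using assms by (auto simp: is_trig_poly_def)
  define L where "L = max J K"
  have pad: "(\<Sum>m\<in>modes I. e m * mode m \<theta>) = (\<Sum>m\<in>modes L. (if m \<in> modes I then e m else 0) * mode m \<theta>)"
    if "I \<le> L" for I e \<theta>
    by (rule sum.mono_neutral_cong_left) (use modes_mono[OF that] in auto)
  have "p \<theta> + q \<theta> = (\<Sum>m\<in>modes L. ((if m \<in> modes J then c m else 0) + (if m \<in> modes K then d m else 0)) * mode m \<theta>)" for \<theta>
    unfolding p q by (subst (1 2) pad) (auto simp: L_def sum.distrib distrib_right)
  thus ?thesis
    unfolding is_trig_poly_def
    by (intro exI[of _ L] exI[of _ "\<lambda>m. (if m \<in> modes J then c m else 0) + (if m \<in> modes K then d m else 0)"]) simp
qed

lemma is_trig_poly_cmult: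
  assumes "is_trig_poly p" shows "is_trig_poly (\<lambda>\<theta>. a * p \<theta>)"
proof -
  obtain J c where p: "\<And>\<theta>. p \<theta> = (\<Sum>m\<in>modes J. c m * mode m \<theta>)"
    using assms by (auto simp: is_trig_poly_def)
  have "a * p \<theta> = (\<Sum>m\<in>modes J. (a * c m) * mode m \<theta>)" for \<theta>
    by (simp add: p sum_distrib_left mult.assoc)
  thus ?thesis unfolding is_trig_poly_def by (intro exI[of _ J] exI[of _ "\<lambda>m. a * c m"]) simp
qed

lemma is_trig_poly_mode: "is_trig_poly (mode m)"
proof (cases "m \<in> modes (snd m)")
  case True
  then have "mode m \<theta> = (\<Sum>n\<in>modes (snd m). (if n = m then 1 else 0) * mode n \<theta>)" for \<theta>
    by (simp add: if_distrib[where f="\<lambda>x. x * _"] cong: if_cong)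
  thus ?thesis unfolding is_trig_poly_def by (intro exI[of _ "snd m"] exI[of _ "\<lambda>n. if n = m then 1 else 0"]) simp
next
  case False
  then have "mode m \<theta> = (\<Sum>n\<in>modes 0. 0 * mode n \<theta>)" for \<theta>
    by (simp add: mem_modes_iff mode_def not_le)
  thus ?thesis unfolding is_trig_poly_def by (intro exI[of _ 0] exI[of _ "\<lambda>n. 0"]) simp
qed

lemma is_trig_poly_const: "is_trig_poly (\<lambda>_. a)"
  using is_trig_poly_cmult[OF is_trig_poly_mode[of "(True, 0)"], of a] by (simp add: mode_def)

lemma is_trig_poly_sum:
  "finite I \<Longrightarrow> (\<And>i. i \<in> I \<Longrightarrow> is_trig_poly (p i)) \<Longrightarrow> is_trig_poly (\<lambda>\<theta>. \<Sum>i\<in>I. p i \<theta>)"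
  by (induction I rule: finite_induct) (auto intro: is_trig_poly_add is_trig_poly_const)

lemma is_trig_poly_cos_int: "is_trig_poly (\<lambda>\<theta>. cos (of_int k * \<theta>))"
proof -
  have "cos (of_int k * \<theta>) = mode (True, nat \<bar>k\<bar>) \<theta>" for \<theta>
    by (cases "k \<ge> 0") (auto simp: mode_def)
  thus ?thesis using is_trig_poly_mode by simp
qed

lemma is_trig_poly_sin_int: "is_trig_poly (\<lambda>\<theta>. sin (of_int k * \<theta>))"
proof -
  have "sin (of_int k * \<theta>) = of_int (sgn k) * mode (False, nat \<bar>k\<bar>) \<theta>" for \<theta>
    by (cases "k = 0"; cases "k \<ge> 0") (auto simp: mode_def)
  thus ?thesis using is_trig_poly_cmult[OF is_trig_poly_mode] by simp
qed

lemma is_trig_poly_mode_mult: "is_trig_poly (\<lambda>\<theta>. mode m \<theta> * mode n \<theta>)"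
proof -
  obtain b j where m: "m = (b, j)" by (cases m)
  obtain c k where n: "n = (c, k)" by (cases n)
  note tp = is_trig_poly_cos_int is_trig_poly_sin_int
  have half: "is_trig_poly (\<lambda>\<theta>. (p \<theta> + q \<theta>) / 2)" "is_trig_poly (\<lambda>\<theta>. (p \<theta> - q \<theta>) / 2)"
    if "is_trig_poly p" "is_trig_poly q" for p q
    using is_trig_poly_cmult[OF is_trig_poly_add[OF that], of "1/2"]
      is_trig_poly_cmult[OF is_trig_poly_add[OF that(1) is_trig_poly_cmult[OF that(2), of "-1"]], of "1/2"]
    by simp_all
  have cs: "cos (real j * \<theta>) * sin (real k * \<theta>) =
     (sin (of_int (int k + int j) * \<theta>) + sin (of_int (int k - int j) * \<theta>)) / 2" for \<theta>
    using sin_mult_cos_nat[of k \<theta> j] by (simp add: mult.commute)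
  show ?thesis
    unfolding m n mode_def fst_conv snd_conv
    by (cases b; cases c)
       (simp_all only: if_True if_False cos_mult_cos_nat sin_mult_sin_nat sin_mult_cos_nat cs,
        (intro half tp)+)
qed

lemma is_trig_poly_mult:
  assumes "is_trig_poly p" "is_trig_poly q"
  shows "is_trig_poly (\<lambda>\<theta>. p \<theta> * q \<theta>)"
proof -
  obtain J c K d where p: "\<And>\<theta>. p \<theta> = (\<Sum>m\<in>modes J. c m * mode m \<theta>)"
    and q: "\<And>\<theta>. q \<theta> = (\<Sum>m\<in>modes K. d m * mode m \<theta>)"
    using assms by (auto simp: is_trig_poly_def)
  have "p \<theta> * q \<theta> = (\<Sum>m\<in>modes J. \<Sum>n\<in>modes K. (c m * d n) * (mode m \<theta> * mode n \<theta>))" for \<theta>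
    unfolding p q sum_product by (simp add: mult_ac)
  thus ?thesis
    by (auto intro!: is_trig_poly_sum is_trig_poly_cmult is_trig_poly_mode_mult)
qed

text \<open>A continuous function with equal values at \<open>-\<pi>\<close> and \<open>\<pi>\<close> is a continuous function on the unit circle,
  where the trigonometric polynomials form an algebra that separates points through the two
  coordinate functions.\<close>

lemma trig_poly_dense:
  fixes f :: "real \<Rightarrow> real"
  assumes f: "continuous_on {-pi..pi} f" "f (-pi) = f pi" and "0 < e"
  obtains J c where "\<And>\<theta>. \<theta> \<in> {-pi..pi} \<Longrightarrow> \<bar>f \<theta> - (\<Sum>m\<in>modes J. c m * mode m \<theta>)\<bar> < e"
proof -
  let ?S = "sphere (0::complex) 1"
  define P where "P g \<longleftrightarrow> continuous_on ?S g \<and> is_trig_poly (\<lambda>\<theta>. g (cis \<theta>))" for g :: "complex \<Rightarrow> real"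
  define F where "F z = f (Arg z)" for z
  have Arg_cis: "Arg (cis \<theta>) = \<theta>" if "-pi < \<theta>" "\<theta> \<le> pi" for \<theta>
    using that by (intro Arg_unique[of 1]) (auto simp: cis_conv_exp)
  have F_cis: "F (cis \<theta>) = f \<theta>" if "\<theta> \<in> {-pi..pi}" for \<theta>
  proof (cases "\<theta> = -pi")
    case True
    then have "cis \<theta> = cis pi" by (simp add: complex_eq_iff)
    with True f(2) Arg_cis[of pi] show ?thesis by (simp add: F_def)
  next
    case False
    with that Arg_cis[of \<theta>] show ?thesis by (simp add: F_def)
  qed
  have S: "cis ` {-pi..pi} = ?S"
  proof safe
    fix z :: complex assume "z \<in> ?S"
    then have "z \<noteq> 0" "cmod z = 1" by auto
    then have "z = cis (Arg z)" using cis_Arg[of z] by (simp add: sgn_eq)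
    moreover have "Arg z \<in> {-pi..pi}" using Arg_le_pi[of z] mpi_less_Arg[of z] by auto
    ultimately show "z \<in> cis ` {-pi..pi}" by blast
  qed auto
  \<comment> \<open>Preimages of closed sets under \<open>F\<close> are images of compact sets under \<open>cis\<close>; this avoids the jump of the argument at \<open>-1\<close>.\<close>
  have "continuous_on ?S F"
    unfolding continuous_on_closed_vimage[OF closed_sphere]
  proof safe
    fix C :: "real set" assume "closed C"
    have "F -` C \<inter> ?S = cis ` ({-pi..pi} \<inter> f -` C)"
      unfolding S[symmetric] using F_cis by auto
    moreover have "closed ({-pi..pi} \<inter> f -` C)"
      using continuous_on_closed_vimage[of "{-pi..pi}" f] f(1) \<open>closed C\<close> by (auto simp: Int_commute)
    then have "compact ({-pi..pi} \<inter> f -` C)"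
      by (metis compact_Icc compact_Int_closed inf.right_idem inf_left_commute inf.idem inf_assoc)
    then have "compact (cis ` ({-pi..pi} \<inter> f -` C))"
      by (intro compact_continuous_image continuous_intros)
    ultimately show "closed (F -` C \<inter> ?S)" by (simp add: compact_imp_closed)
  qed
  moreover have "\<exists>g. P g \<and> g x \<noteq> g y" if "x \<in> ?S \<and> y \<in> ?S \<and> x \<noteq> y" for x y
  proof -
    have "P Re" "P Im"
      using is_trig_poly_mode[of "(True, 1)"] is_trig_poly_mode[of "(False, 1)"]
      by (auto simp: P_def mode_def[abs_def] intro!: continuous_intros)
    with that show ?thesis by (metis complex_eq_iff)
  qed
  ultimately have "\<exists>g. P g \<and> (\<forall>z\<in>?S. \<bar>F z - g z\<bar> < e)"
    using \<open>0 < e\<close>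
    by (intro Stone_Weierstrass_HOL)
       (auto simp: P_def intro!: continuous_intros is_trig_poly_const is_trig_poly_add is_trig_poly_mult)
  then obtain g where g: "P g" "\<And>z. z \<in> ?S \<Longrightarrow> \<bar>F z - g z\<bar> < e"
    by blast
  obtain J c where "\<And>\<theta>. g (cis \<theta>) = (\<Sum>m\<in>modes J. c m * mode m \<theta>)"
    using g(1) by (auto simp: P_def is_trig_poly_def)
  then have "\<bar>f \<theta> - (\<Sum>m\<in>modes J. c m * mode m \<theta>)\<bar> < e" if "\<theta> \<in> {-pi..pi}" for \<theta>
    using g(2)[of "cis \<theta>"] F_cis[OF that] by simp
  then show ?thesis by (rule that)
qed

section \<open>Parseval's identity\<close>

text \<open>The partial sums increase and are bounded by Bessel's inequality; by best approximation, they come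
  as close to the bound as trigonometric polynomials come to \<open>f\<close>.\<close>

lemma parseval_real:
  fixes f :: "real \<Rightarrow> real"
  assumes f: "continuous_on {-pi..pi} f" "f (-pi) = f pi"
  shows "(\<lambda>n. \<Sum>m\<in>modes n. mode_weight m * (fcoef f m)\<^sup>2) \<longlonglongrightarrow> (1 / pi) * integral {-pi..pi} (\<lambda>\<theta>. (f \<theta>)\<^sup>2)"
proof -
  let ?I = "integral {-pi..pi} (\<lambda>\<theta>. (f \<theta>)\<^sup>2)"
  let ?s = "\<lambda>n. \<Sum>m\<in>modes n. mode_weight m * (fcoef f m)\<^sup>2"
  have mono: "?s n \<le> ?s k" if "n \<le> k" for n k
    by (rule sum_mono2) (use modes_mono[OF that] in \<open>auto simp: less_imp_le\<close>)
  have upper: "pi * ?s n \<le> ?I" for n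
  proof -
    have "0 \<le> integral {-pi..pi} (\<lambda>\<theta>. (f \<theta> - (\<Sum>m\<in>modes n. fcoef f m * mode m \<theta>))\<^sup>2)"
      by (intro integral_nonneg integrable_continuous_real continuous_intros f) auto
    then show ?thesis
      unfolding integral_square_diff_trig_sum[OF f(1)] by simp
  qed
  have lower: "\<exists>N. \<forall>n\<ge>N. ?I - pi * ?s n \<le> 2 * pi * e\<^sup>2" if e: "0 < e" for e
  proof -
    obtain J c where Jc: "\<And>\<theta>. \<theta> \<in> {-pi..pi} \<Longrightarrow> \<bar>f \<theta> - (\<Sum>m\<in>modes J. c m * mode m \<theta>)\<bar> < e"
      using trig_poly_dense[OF f e] by metis
    have "integral {-pi..pi} (\<lambda>\<theta>. (f \<theta> - (\<Sum>m\<in>modes J. c m * mode m \<theta>))\<^sup>2) \<le> integral {-pi..pi} (\<lambda>\<theta>. e\<^sup>2)"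
      using Jc
      by (intro integral_le integrable_continuous_real continuous_intros f)
         (metis abs_le_square_iff abs_of_pos e less_imp_le)
    then have "?I - pi * ?s J \<le> 2 * pi * e\<^sup>2"
      unfolding integral_square_diff_trig_sum[OF f(1)]
      using sum_nonneg[of "modes J" "\<lambda>m. mode_weight m * (fcoef f m - c m)\<^sup>2"]
      by (simp add: less_imp_le) (smt (verit, best) mult_nonneg_nonneg pi_ge_zero)
    then show ?thesis
      using mono by (intro exI[of _ J]) (smt (verit) mult_left_mono pi_ge_zero)
  qed
  have "(\<lambda>n. pi * ?s n) \<longlonglongrightarrow> ?I"
  proof (rule LIMSEQ_I)
    fix r :: real assume r: "0 < r"
    \<comment> \<open>Chosen such that \<open>2\<pi>e\<^sup>2 = r / 2\<close>.\<close>
    define e where "e = sqrt (r / (4 * pi))"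
    have "0 < e" "2 * pi * e\<^sup>2 < r" using r by (auto simp: e_def field_simps)
    with lower[of e] obtain N where "\<forall>n\<ge>N. ?I - pi * ?s n < r" by force
    with upper show "\<exists>N. \<forall>n\<ge>N. norm (pi * ?s n - ?I) < r"
      by (intro exI[of _ N] allI impI) (smt (verit) real_norm_def)
  qed
  from tendsto_mult[OF tendsto_const[of "1/pi"] this] show ?thesis by simp
qed

lemma parseval:
  fixes f :: "real \<Rightarrow> 'a::euclidean_space"
  assumes f: "continuous_on {-pi..pi} f" "f (-pi) = f pi"
  shows "(\<lambda>n. \<Sum>m\<in>modes n. mode_weight m * (norm (fcoef f m))\<^sup>2) \<longlonglongrightarrow>
           (1 / pi) * integral {-pi..pi} (\<lambda>\<theta>. (norm (f \<theta>))\<^sup>2)"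
proof -
  have norm2: "(norm x)\<^sup>2 = (\<Sum>b\<in>Basis. (x \<bullet> b)\<^sup>2)" for x :: 'a
    by (subst power2_norm_eq_inner, subst euclidean_inner) (simp add: power2_eq_square)
  have lin: "fcoef f m \<bullet> b = fcoef (\<lambda>\<theta>. f \<theta> \<bullet> b) m" if "m \<in> modes n" for m n b
    using fcoef_linear_image[OF bounded_linear_inner_left f(1) that] by simp
  have "(\<Sum>m\<in>modes n. mode_weight m * (norm (fcoef f m))\<^sup>2) =
        (\<Sum>b\<in>Basis. \<Sum>m\<in>modes n. mode_weight m * (fcoef (\<lambda>\<theta>. f \<theta> \<bullet> b) m)\<^sup>2)" for n
    unfolding norm2 sum_distrib_left by (subst sum.swap) (auto intro!: sum.cong simp: lin)
  moreover have "(1 / pi) * integral {-pi..pi} (\<lambda>\<theta>. (norm (f \<theta>))\<^sup>2) =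
        (\<Sum>b\<in>Basis. (1 / pi) * integral {-pi..pi} (\<lambda>\<theta>. (f \<theta> \<bullet> b)\<^sup>2))"
    unfolding norm2 sum_distrib_left[symmetric]
    by (subst integral_sum) (auto intro!: integrable_continuous_real continuous_intros f)
  moreover have "(\<lambda>n. \<Sum>m\<in>modes n. mode_weight m * (fcoef (\<lambda>\<theta>. f \<theta> \<bullet> b) m)\<^sup>2) \<longlonglongrightarrow>
      (1 / pi) * integral {-pi..pi} (\<lambda>\<theta>. (f \<theta> \<bullet> b)\<^sup>2)" for b
    by (rule parseval_real) (use f in \<open>auto intro!: continuous_intros\<close>)
  ultimately show ?thesis
    by (simp only: tendsto_sum)
qed

section \<open>Random series and continuous paths\<close>

text \<open>The series converges uniformly, hence to a continuous function, and two continuous functions that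
  agree on a dense set are equal; so pointwise convergence on the dense set \<open>D\<close> is enough to integrate
  the series for \<open>g\<close> term by term.\<close>

lemma fcoef_of_summable_series:
  fixes g :: "real \<Rightarrow> real" and a :: "bool \<times> nat \<Rightarrow> real"
  assumes g: "continuous_on {-pi..pi} g"
    and a: "summable (\<lambda>j. \<bar>a (True, j)\<bar> + \<bar>a (False, j)\<bar>)"
    and D: "D \<subseteq> {-pi..pi}" "{-pi..pi} \<subseteq> closure D"
    and sums: "\<And>\<theta>. \<theta> \<in> D \<Longrightarrow> (\<lambda>j. a (True, j) * mode (True, j) \<theta> + a (False, j) * mode (False, j) \<theta>) sums g \<theta>"
    and m: "m \<in> modes J"
  shows "fcoef g m = a m"
proof -
  define summand where "summand j \<theta> = a (True, j) * mode (True, j) \<theta> + a (False, j) * mode (False, j) \<theta>" for j \<theta>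
  define h where "h \<theta> = (\<Sum>j. summand j \<theta>)" for \<theta>
  have summand_le: "\<bar>summand j \<theta>\<bar> \<le> \<bar>a (True, j)\<bar> + \<bar>a (False, j)\<bar>" for j \<theta>
    unfolding summand_def
    by (rule order_trans[OF abs_triangle_ineq])
       (auto simp: abs_mult intro!: add_mono mult_left_le abs_mode_le_1)
  have summable: "summable (\<lambda>j. summand j \<theta>)" for \<theta>
    by (rule summable_comparison_test'[OF a, of 0]) (use summand_le in auto)
  have ul: "uniform_limit {-pi..pi} (\<lambda>n \<theta>. \<Sum>j<n. mode k \<theta> * summand j \<theta>) (\<lambda>\<theta>. mode k \<theta> * h \<theta>) sequentially" for k
  proof -
    have "uniform_limit {-pi..pi} (\<lambda>n \<theta>. \<Sum>j<n. mode k \<theta> * summand j \<theta>) (\<lambda>\<theta>. \<Sum>j. mode k \<theta> * summand j \<theta>) sequentially"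
    proof (rule Weierstrass_m_test[OF _ a])
      fix j \<theta>
      show "norm (mode k \<theta> * summand j \<theta>) \<le> \<bar>a (True, j)\<bar> + \<bar>a (False, j)\<bar>"
        using mult_mono[OF abs_mode_le_1 summand_le, of j \<theta> k \<theta>] by (simp add: abs_mult)
    qed
    thus ?thesis by (simp add: h_def suminf_mult[OF summable])
  qed
  \<comment> \<open>Uniform convergence is known after multiplication by any mode; the constant mode gives it for the series itself.\<close>
  have "continuous_on {-pi..pi} (\<lambda>\<theta>. mode (True, 0) \<theta> * h \<theta>)"
    by (rule uniform_limit_theorem[OF always_eventually ul])
       (auto simp: summand_def intro!: continuous_intros)
  then have h: "continuous_on {-pi..pi} h" by (simp add: mode_def)
  have cl: "closure D = {-pi..pi}"
    using D closure_minimal[OF D(1)] by auto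
  have hg: "h \<theta> = g \<theta>" if "\<theta> \<in> {-pi..pi}" for \<theta>
  proof -
    have "h \<theta> - g \<theta> = 0"
    proof (rule continuous_constant_on_closure[of D "\<lambda>\<theta>. h \<theta> - g \<theta>"])
      show "continuous_on (closure D) (\<lambda>\<theta>. h \<theta> - g \<theta>)"
        unfolding cl by (intro continuous_intros h g)
      show "h \<theta> - g \<theta> = 0" if "\<theta> \<in> D" for \<theta>
        using sums_unique[OF sums[OF that]] by (simp add: h_def summand_def)
    qed (use that cl in auto)
    then show ?thesis by simp
  qed
  obtain I L where I: "\<And>n. ((\<lambda>\<theta>. \<Sum>j<n. mode m \<theta> * summand j \<theta>) has_integral I n) {-pi..pi}"
    and L: "((\<lambda>\<theta>. mode m \<theta> * h \<theta>) has_integral L) {-pi..pi}" and lim: "I \<longlonglongrightarrow> L"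
    by (rule uniform_limit_integral[OF ul[of m]])
       (auto simp: summand_def intro!: continuous_intros)
  have "I n = pi * mode_weight m * a m" if "n > snd m" for n
  proof -
    let ?c = "pi * mode_weight m"
    have "((\<lambda>\<theta>. \<Sum>j<n. a (True, j) * (mode m \<theta> * mode (True, j) \<theta>) + a (False, j) * (mode m \<theta> * mode (False, j) \<theta>))
        has_integral (\<Sum>j<n. a (True, j) * (if m = (True, j) then ?c else 0) + a (False, j) * (if m = (False, j) then ?c else 0))) {-pi..pi}"
      by (intro has_integral_sum has_integral_add has_integral_mult_right mode_orthogonal[OF m]) auto
    then have "I n = (\<Sum>j<n. a (True, j) * (if m = (True, j) then ?c else 0) + a (False, j) * (if m = (False, j) then ?c else 0))"
      by (intro has_integral_unique[OF I]) (simp add: summand_def algebra_simps)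
    also have "\<dots> = (\<Sum>j<n. if j = snd m then a m * ?c else 0)"
      by (intro sum.cong refl) (cases m; auto)
    finally show ?thesis using that by simp
  qed
  then have "\<forall>\<^sub>F n in sequentially. I n = pi * mode_weight m * a m"
    by (intro eventually_mono[OF eventually_gt_at_top[of "snd m"]])
  then have "I \<longlonglongrightarrow> pi * mode_weight m * a m"
    by (rule tendsto_eventually)
  with lim have "L = pi * mode_weight m * a m"
    by (rule LIMSEQ_unique)
  moreover have "integral {-pi..pi} (\<lambda>\<theta>. mode m \<theta> *\<^sub>R g \<theta>) = L"
    unfolding integral_unique[OF L, symmetric] by (intro integral_cong) (simp add: hg)
  ultimately show ?thesis
    by (simp add: fcoef_eq_integral[OF m] mode_weight_pos[THEN less_imp_neq, symmetric])
qed

text \<open>The expectation of \<open>\<Sum>j. w\<^sub>j W\<^sub>j\<^sup>2\<close> with \<open>w\<^sub>j = j\<^bsup>2 + \<epsilon>\<^esup>\<close> is finite, so this sum is finite almost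
  surely, and \<open>\<bar>W\<^sub>j\<bar> \<le> w\<^sub>j W\<^sub>j\<^sup>2 + 1 / w\<^sub>j\<close> for \<open>j \<ge> 1\<close> transfers summability to \<open>\<bar>W\<^sub>j\<bar>\<close>.\<close>

lemma AE_summable_if_second_moments:
  fixes W :: "nat \<Rightarrow> 'w \<Rightarrow> real"
  assumes [measurable]: "\<And>j. W j \<in> borel_measurable M"
    and W2: "\<And>j. integrable M (\<lambda>\<omega>. (W j \<omega>)\<^sup>2)" "\<And>j. (LINT \<omega>|M. (W j \<omega>)\<^sup>2) = s j"
    and s: "0 < \<epsilon>" "summable (\<lambda>j. real j powr (2 + \<epsilon>) * s j)"
  shows "AE \<omega> in M. summable (\<lambda>j. \<bar>W j \<omega>\<bar>)"
proof -
  let ?w = "\<lambda>j. real j powr (2 + \<epsilon>)"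
  have "(\<integral>\<^sup>+\<omega>. (\<Sum>j. ennreal (?w j * (W j \<omega>)\<^sup>2)) \<partial>M) = (\<Sum>j. \<integral>\<^sup>+\<omega>. ennreal (?w j * (W j \<omega>)\<^sup>2) \<partial>M)"
    by (intro nn_integral_suminf) measurable
  also have "\<dots> = (\<Sum>j. ennreal (?w j * s j))"
    by (subst nn_integral_eq_integral) (auto simp: W2)
  also have "\<dots> \<noteq> \<infinity>"
  proof -
    have "0 \<le> s j" for j unfolding W2(2)[symmetric] by simp
    then show ?thesis using s(2) by (simp add: suminf_ennreal_eq[OF _ summable_sums])
  qed
  finally have "AE \<omega> in M. (\<Sum>j. ennreal (?w j * (W j \<omega>)\<^sup>2)) \<noteq> \<infinity>"
    by (intro nn_integral_PInf_AE) auto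
  then show ?thesis
  proof eventually_elim
    case (elim \<omega>)
    then have 1: "summable (\<lambda>j. ?w j * (W j \<omega>)\<^sup>2)"
      by (intro summable_suminf_not_top) auto
    have 2: "summable (\<lambda>j. real j powr (- (2 + \<epsilon>)))"
      using s(1) by (simp add: summable_real_powr_iff)
    show ?case
    proof (rule summable_comparison_test'[OF summable_add[OF 1 2], of 1])
      fix j :: nat assume "1 \<le> j"
      then have w: "?w j > 0" "real j powr (- (2 + \<epsilon>)) = 1 / ?w j"
        using powr_minus_divide[of "real j" "2 + \<epsilon>"] by auto
      \<comment> \<open>The inequality is \<open>2xy \<le> x\<^sup>2 + y\<^sup>2\<close> with \<open>x\<^sup>2 = w W\<^sup>2\<close> and \<open>y\<^sup>2 = 1 / w\<close>, where one of the two copies of \<open>xy\<close> is given away.\<close>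
      have "0 \<le> (?w j * \<bar>W j \<omega>\<bar> - 1)\<^sup>2 + ?w j * \<bar>W j \<omega>\<bar>"
        using w by (intro add_nonneg_nonneg mult_nonneg_nonneg) auto
      also have "\<dots> = ?w j * (?w j * (W j \<omega>)\<^sup>2 - \<bar>W j \<omega>\<bar> + 1 / ?w j)"
        using w(1) by (simp add: power2_eq_square field_simps)
      finally have "0 \<le> ?w j * (W j \<omega>)\<^sup>2 - \<bar>W j \<omega>\<bar> + 1 / ?w j"
        using w(1) by (simp add: zero_le_mult_iff)
      then show "norm \<bar>W j \<omega>\<bar> \<le> ?w j * (W j \<omega>)\<^sup>2 + real j powr (- (2 + \<epsilon>))"
        unfolding w(2) by simp
    qed
  qed
qed

text \<open>Sampling the parameter on finer and finer grids exhibits the process as a pointwise limit of jointly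
  measurable step processes; joint measurability makes the integral over the parameter measurable.\<close>

lemma borel_measurable_integral_continuous_paths:
  fixes Y :: "real \<Rightarrow> 'w \<Rightarrow> real"
  assumes meas: "\<And>\<theta>. \<theta> \<in> {a..b} \<Longrightarrow> Y \<theta> \<in> borel_measurable M"
    and cont: "\<And>\<omega>. \<omega> \<in> space M \<Longrightarrow> continuous_on {a..b} (\<lambda>\<theta>. Y \<theta> \<omega>)"
    and "a \<le> b"
  shows "(\<lambda>\<omega>. integral {a..b} (\<lambda>\<theta>. Y \<theta> \<omega>)) \<in> borel_measurable M"
proof -
  \<comment> \<open>Clamping the parameter extends the process continuously to the whole line, so that grid points outside the interval do no harm.\<close>
  define c where "c \<theta> = max a (min b \<theta>)" for \<theta>
  have c: "c \<theta> \<in> {a..b}" for \<theta> using \<open>a \<le> b\<close> by (auto simp: c_def)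
  have c_id: "c \<theta> = \<theta>" if "\<theta> \<in> {a..b}" for \<theta> using that by (auto simp: c_def)
  have "continuous_on UNIV c" unfolding c_def by (intro continuous_intros)
  then have contc: "continuous_on UNIV (\<lambda>\<theta>. Y (c \<theta>) \<omega>)" if "\<omega> \<in> space M" for \<omega>
    by (rule continuous_on_compose2[OF cont[OF that]]) (use c in auto)
  have [measurable]: "(\<lambda>(\<omega>, \<theta>). Y (c \<theta>) \<omega>) \<in> borel_measurable (M \<Otimes>\<^sub>M lborel)"
  proof (rule borel_measurable_LIMSEQ_metric)
    fix n :: nat
    show "(\<lambda>x. Y (c (real_of_int \<lfloor>real (Suc n) * snd x\<rfloor> / real (Suc n))) (fst x)) \<in> borel_measurable (M \<Otimes>\<^sub>M lborel)"
      by (rule measurable_compose_countable[where f = "\<lambda>i x. Y (c (real_of_int i / real (Suc n))) (fst x)"])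
         (use meas[OF c] in measurable)
  next
    fix x :: "'w \<times> real" assume "x \<in> space (M \<Otimes>\<^sub>M lborel)"
    then have x: "fst x \<in> space M" by (auto simp: space_pair_measure)
    have "(\<lambda>n. real_of_int \<lfloor>real (Suc n) * \<theta>\<rfloor> / real (Suc n)) \<longlonglongrightarrow> \<theta>" for \<theta>
    proof (rule tendsto_sandwich[OF _ _ _ tendsto_const])
      show "(\<lambda>n. \<theta> - 1 / real (Suc n)) \<longlonglongrightarrow> \<theta>"
        using tendsto_diff[OF tendsto_const LIMSEQ_inverse_real_of_nat, of \<theta>] by (simp add: inverse_eq_divide)
      show "\<forall>\<^sub>F n in sequentially. \<theta> - 1 / real (Suc n) \<le> real_of_int \<lfloor>real (Suc n) * \<theta>\<rfloor> / real (Suc n)"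
      proof (rule always_eventually, rule allI)
        fix n
        have "real (Suc n) * \<theta> - 1 \<le> real_of_int \<lfloor>real (Suc n) * \<theta>\<rfloor>" by linarith
        from divide_right_mono[OF this, of "real (Suc n)"]
        show "\<theta> - 1 / real (Suc n) \<le> real_of_int \<lfloor>real (Suc n) * \<theta>\<rfloor> / real (Suc n)"
          by (simp add: diff_divide_distrib)
      qed
      show "\<forall>\<^sub>F n in sequentially. real_of_int \<lfloor>real (Suc n) * \<theta>\<rfloor> / real (Suc n) \<le> \<theta>"
      proof (rule always_eventually, rule allI)
        fix n
        have "real_of_int \<lfloor>real (Suc n) * \<theta>\<rfloor> \<le> real (Suc n) * \<theta>" by linarith
        from divide_right_mono[OF this, of "real (Suc n)"]
        show "real_of_int \<lfloor>real (Suc n) * \<theta>\<rfloor> / real (Suc n) \<le> \<theta>" by simp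
      qed
    qed
    then have "(\<lambda>n. Y (c (real_of_int \<lfloor>real (Suc n) * snd x\<rfloor> / real (Suc n))) (fst x)) \<longlonglongrightarrow> Y (c (snd x)) (fst x)"
      by (rule continuous_on_tendsto_compose[OF contc[OF x]]) auto
    then show "(\<lambda>n. Y (c (real_of_int \<lfloor>real (Suc n) * snd x\<rfloor> / real (Suc n))) (fst x)) \<longlonglongrightarrow> (case x of (\<omega>, \<theta>) \<Rightarrow> Y (c \<theta>) \<omega>)"
      by (simp add: split_beta)
  qed
  have "(\<lambda>\<omega>. LINT \<theta>|lborel. indicator {a..b} \<theta> *\<^sub>R Y (c \<theta>) \<omega>) \<in> borel_measurable M"
    by measurable
  moreover have "integral {a..b} (\<lambda>\<theta>. Y \<theta> \<omega>) = (LINT \<theta>|lborel. indicator {a..b} \<theta> *\<^sub>R Y (c \<theta>) \<omega>)"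
    if "\<omega> \<in> space M" for \<omega>
  proof -
    have "set_integrable lborel {a..b} (\<lambda>\<theta>. Y (c \<theta>) \<omega>)"
      by (intro borel_integrable_atLeastAtMost' continuous_on_subset[OF contc[OF that]]) auto
    from set_borel_integral_eq_integral(2)[OF this]
    show ?thesis
      unfolding set_lebesgue_integral_def by (metis (no_types, lifting) c_id integral_cong)
  qed
  ultimately show ?thesis
    by (simp cong: measurable_cong)
qed

lemma borel_measurable_fcoef:
  fixes Y :: "real \<Rightarrow> 'w \<Rightarrow> real ^ 'n"
  assumes meas: "\<And>\<theta>. \<theta> \<in> {-pi..pi} \<Longrightarrow> Y \<theta> \<in> borel_measurable M"
    and cont: "\<And>\<omega>. \<omega> \<in> space M \<Longrightarrow> continuous_on {-pi..pi} (\<lambda>\<theta>. Y \<theta> \<omega>)"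
    and m: "m \<in> modes J"
  shows "(\<lambda>\<omega>. fcoef (\<lambda>\<theta>. Y \<theta> \<omega>) m $ i) \<in> borel_measurable M"
proof -
  have "(\<lambda>\<omega>. integral {-pi..pi} (\<lambda>\<theta>. mode m \<theta> * Y \<theta> \<omega> $ i)) \<in> borel_measurable M"
  proof (rule borel_measurable_integral_continuous_paths)
    show "(\<lambda>\<omega>. mode m \<theta> * Y \<theta> \<omega> $ i) \<in> borel_measurable M" if "\<theta> \<in> {-pi..pi}" for \<theta>
      using measurable_compose[OF meas[OF that] borel_measurable_nth[of i]] by simp
    show "continuous_on {-pi..pi} (\<lambda>\<theta>. mode m \<theta> * Y \<theta> \<omega> $ i)" if "\<omega> \<in> space M" for \<omega>
      by (intro continuous_intros cont that)
  qed simp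
  then have "(\<lambda>\<omega>. fcoef (\<lambda>\<theta>. Y \<theta> \<omega> $ i) m) \<in> borel_measurable M"
    unfolding fcoef_eq_integral[OF m] by simp
  also have "?this \<longleftrightarrow> ?thesis"
    by (intro measurable_cong fcoef_linear_image[OF bounded_linear_vec_nth cont m])
  finally show ?thesis .
qed

section \<open>Independent families\<close>

context prob_space
begin

text \<open>Measurability of \<open>Y\<close> is assumed because an almost sure equality does not imply it on a measure space
  that need not be complete.\<close>

lemma indep_vars_cong_AE:
  assumes X: "indep_vars M' X I"
    and Y: "\<And>i. i \<in> I \<Longrightarrow> Y i \<in> measurable M (M' i)"
    and eq: "\<And>i. i \<in> I \<Longrightarrow> AE x in M. X i x = Y i x"
  shows "indep_vars M' Y I"
  unfolding indep_vars_def2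
proof (intro conjI ballI Y indep_setsI)
  fix i assume "i \<in> I"
  then show "{Y i -` A \<inter> space M |A. A \<in> sets (M' i)} \<subseteq> events"
    using measurable_sets[OF Y] by auto
next
  fix A J assume J: "J \<noteq> {}" "J \<subseteq> I" "finite J"
    and "\<forall>j\<in>J. A j \<in> {Y j -` B \<inter> space M |B. B \<in> sets (M' j)}"
  then obtain B where B: "\<And>j. j \<in> J \<Longrightarrow> A j = Y j -` B j \<inter> space M" "\<And>j. j \<in> J \<Longrightarrow> B j \<in> sets (M' j)"
    by simp metis
  have Xm: "i \<in> I \<Longrightarrow> X i \<in> measurable M (M' i)" for i
    using X by (simp add: indep_vars_def2)
  have AE: "AE x in M. \<forall>j\<in>J. X j x = Y j x"
    using J eq by (intro AE_finite_allI) auto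
  have sX: "X j -` B j \<inter> space M \<in> events" and sA: "A j \<in> events" if "j \<in> J" for j
    using that J B Xm Y measurable_sets by auto
  have "prob (\<Inter>j\<in>J. A j) = prob (\<Inter>j\<in>J. X j -` B j \<inter> space M)"
  proof (rule finite_measure_eq_AE)
    show "AE x in M. (x \<in> (\<Inter>j\<in>J. A j)) = (x \<in> (\<Inter>j\<in>J. X j -` B j \<inter> space M))"
      using AE by eventually_elim (simp add: B(1))
  qed (use J sX sA in \<open>intro sets.finite_INT; simp\<close>)+
  also have "\<dots> = (\<Prod>j\<in>J. prob (X j -` B j \<inter> space M))"
    by (rule indep_varsD[OF X]) (use J B in auto)
  also have "\<dots> = (\<Prod>j\<in>J. prob (A j))"
  proof (rule prod.cong[OF refl], rule finite_measure_eq_AE)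
    fix j assume j: "j \<in> J"
    show "AE x in M. (x \<in> X j -` B j \<inter> space M) = (x \<in> A j)"
      using AE by eventually_elim (use j B(1) in auto)
  qed (use sX sA in auto)
  finally show "prob (\<Inter>j\<in>J. A j) = (\<Prod>j\<in>J. prob (A j))" .
qed

lemma indep_vars_grouped:
  assumes X: "indep_vars M' X I"
    and K: "\<And>j. j \<in> L \<Longrightarrow> K j \<subseteq> I" "disjoint_family_on K L"
    and g: "\<And>j. j \<in> L \<Longrightarrow> g j \<in> measurable (PiM (K j) M') (N j)"
    and Y: "\<And>j x. j \<in> L \<Longrightarrow> x \<in> space M \<Longrightarrow> Y j x = g j (\<lambda>i\<in>K j. X i x)"
  shows "indep_vars N Y L"
proof -
  have ind: "indep_vars N (\<lambda>j x. g j (\<lambda>i\<in>K j. X i x)) L"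
    by (rule indep_vars_compose2[OF indep_vars_restrict[OF X K] g])
  then have "(\<lambda>x. g j (\<lambda>i\<in>K j. X i x)) \<in> measurable M (N j)" if "j \<in> L" for j
    using that by (simp add: indep_vars_def2)
  then have "Y j \<in> measurable M (N j)" if "j \<in> L" for j
    using that by (subst measurable_cong[OF Y[OF that]]) auto
  with ind show ?thesis
    by (rule indep_vars_cong_AE) (auto simp: Y)
qed

lemma indep_vars_inj:
  assumes "indep_vars (\<lambda>_. N) X I" "inj_on f L" "f ` L \<subseteq> I"
  shows "indep_vars (\<lambda>_. N) (\<lambda>j. X (f j)) L"
  by (rule indep_vars_grouped[OF assms(1), where K = "\<lambda>j. {f j}" and g = "\<lambda>j x. x (f j)"])
     (use assms(2,3) in \<open>auto simp: disjoint_family_on_def inj_on_def\<close>)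

end

text \<open>On a product of two probability spaces the variables read off the first factor are independent of
  those read off the second; this is how missing variables are supplied by enlarging the space.\<close>

lemma indep_vars_pair_measure:
  assumes "prob_space M" "prob_space P"
    and X: "prob_space.indep_vars M N X I" and Y: "prob_space.indep_vars P N Y L"
  shows "prob_space.indep_vars (M \<Otimes>\<^sub>M P) N (\<lambda>i \<omega>. if i \<in> I then X i (fst \<omega>) else Y i (snd \<omega>)) (I \<union> L)"
proof -
  interpret M: prob_space M by fact
  interpret P: prob_space P by fact
  interpret MP: pair_prob_space M P ..
  let ?Z = "\<lambda>i \<omega>. if i \<in> I then X i (fst \<omega>) else Y i (snd \<omega>)"
  have Xm[measurable]: "i \<in> I \<Longrightarrow> X i \<in> measurable M (N i)" for i
    using X by (simp add: M.indep_vars_def2)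
  have Ym[measurable]: "i \<in> L \<Longrightarrow> Y i \<in> measurable P (N i)" for i
    using Y by (simp add: P.indep_vars_def2)
  have Zm: "?Z i \<in> measurable (M \<Otimes>\<^sub>M P) (N i)" if "i \<in> I \<union> L" for i
    using that by (cases "i \<in> I") auto
  show ?thesis
    unfolding MP.indep_vars_def2
  proof (intro conjI ballI Zm MP.indep_setsI)
    fix i assume "i \<in> I \<union> L"
    then show "{?Z i -` A \<inter> space (M \<Otimes>\<^sub>M P) |A. A \<in> sets (N i)} \<subseteq> sets (M \<Otimes>\<^sub>M P)"
      using measurable_sets[OF Zm] by auto
  next
    fix A J assume J: "J \<noteq> {}" "J \<subseteq> I \<union> L" "finite J"
      and "\<forall>j\<in>J. A j \<in> {?Z j -` B \<inter> space (M \<Otimes>\<^sub>M P) |B. B \<in> sets (N j)}"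
    then obtain B where B: "\<And>j. j \<in> J \<Longrightarrow> A j = ?Z j -` B j \<inter> space (M \<Otimes>\<^sub>M P)" "\<And>j. j \<in> J \<Longrightarrow> B j \<in> sets (N j)"
      by simp metis
    define U where "U j = X j -` B j \<inter> space M" for j
    define V where "V j = Y j -` B j \<inter> space P" for j
    have UV: "j \<in> J \<inter> I \<Longrightarrow> U j \<in> sets M" "j \<in> J - I \<Longrightarrow> V j \<in> sets P" for j
      using J B(2)[of j] by (auto simp: U_def V_def intro!: measurable_sets[OF Xm] measurable_sets[OF Ym])
    have AU: "A j = U j \<times> space P" if "j \<in> J \<inter> I" for j
      using that B(1)[of j] by (auto simp: U_def space_pair_measure)
    have AV: "A j = space M \<times> V j" if "j \<in> J - I" for j
      using that B(1)[of j] by (auto simp: V_def space_pair_measure)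
    define E where "E = space M \<inter> (\<Inter>j\<in>J \<inter> I. U j)"
    define F where "F = space P \<inter> (\<Inter>j\<in>J - I. V j)"
    have "E \<in> sets M"
    proof (cases "J \<inter> I = {}")
      case False
      then show ?thesis unfolding E_def using UV(1) J(3) by (intro sets.Int sets.top sets.finite_INT) auto
    qed (simp add: E_def)
    moreover have "F \<in> sets P"
    proof (cases "J - I = {}")
      case False
      then show ?thesis unfolding F_def using UV(2) J(3) by (intro sets.Int sets.top sets.finite_INT) auto
    qed (simp only: F_def INT_empty Int_UNIV_right sets.top)
    ultimately have EF: "E \<in> sets M" "F \<in> sets P" .
    have times: "measure (M \<Otimes>\<^sub>M P) (C \<times> D) = measure M C * measure P D" if "C \<in> sets M" "D \<in> sets P" for C D
      using that by (simp add: measure_def P.emeasure_pair_measure_Times enn2real_mult)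
    have mem: "(p, q) \<in> A j \<longleftrightarrow> p \<in> space M \<and> q \<in> space P \<and> (if j \<in> I then p \<in> U j else q \<in> V j)"
      if "j \<in> J" for p q j
      using B(1)[OF that] by (auto simp: U_def V_def space_pair_measure)
    have "(p, q) \<in> (\<Inter>j\<in>J. A j) \<longleftrightarrow> (p, q) \<in> E \<times> F" for p q
      using J(1) by (auto simp: mem E_def F_def)
    then have "(\<Inter>j\<in>J. A j) = E \<times> F" by auto
    then have "measure (M \<Otimes>\<^sub>M P) (\<Inter>j\<in>J. A j) = measure M E * measure P F"
      by (simp add: times EF)
    also have "measure M E = (\<Prod>j\<in>J \<inter> I. measure M (U j))"
    proof (cases "J \<inter> I = {}")
      case False
      have "E = (\<Inter>j\<in>J \<inter> I. X j -` B j \<inter> space M)" using False by (auto simp: E_def U_def)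
      then show ?thesis unfolding U_def
        using M.indep_varsD[OF X False, of B] J(3) B(2) by auto
    qed (simp add: E_def M.prob_space)
    also have "measure P F = (\<Prod>j\<in>J - I. measure P (V j))"
    proof (cases "J - I = {}")
      case False
      then have "F = (\<Inter>j\<in>J - I. Y j -` B j \<inter> space P)" by (auto simp: F_def V_def)
      moreover have "measure P (\<Inter>j\<in>J - I. Y j -` B j \<inter> space P) = (\<Prod>j\<in>J - I. measure P (Y j -` B j \<inter> space P))"
        by (rule P.indep_varsD[OF Y False]) (use J B(2) in auto)
      ultimately show ?thesis by (simp only: V_def)
    qed (simp only: F_def INT_empty Int_UNIV_right P.prob_space prod.empty)
    also have "(\<Prod>j\<in>J \<inter> I. measure M (U j)) = (\<Prod>j\<in>J \<inter> I. measure (M \<Otimes>\<^sub>M P) (A j))"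
      by (intro prod.cong refl) (simp add: AU times UV P.prob_space)
    also have "(\<Prod>j\<in>J - I. measure P (V j)) = (\<Prod>j\<in>J - I. measure (M \<Otimes>\<^sub>M P) (A j))"
      by (intro prod.cong refl) (simp add: AV times UV M.prob_space)
    finally show "measure (M \<Otimes>\<^sub>M P) (\<Inter>j\<in>J. A j) = (\<Prod>j\<in>J. measure (M \<Otimes>\<^sub>M P) (A j))"
      using prod.Int_Diff[OF J(3), of "\<lambda>j. measure (M \<Otimes>\<^sub>M P) (A j)" I] by simp
  qed
qed

lemma indep_vars_PiM_coordinates:
  assumes "\<And>i. prob_space (D i)" and "I \<noteq> {}"
  shows "prob_space.indep_vars (PiM I D) D (\<lambda>i x. x i) I"
proof -
  interpret prob_space "PiM I D" by (intro prob_space_PiM assms)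
  have "distr (PiM I D) (PiM I D) (\<lambda>x. \<lambda>i\<in>I. x i) = distr (PiM I D) (PiM I D) (\<lambda>x. x)"
    by (rule distr_cong) (auto simp: space_PiM)
  also have "\<dots> = PiM I (\<lambda>i. distr (PiM I D) (D i) (\<lambda>x. x i))"
    unfolding distr_id by (intro PiM_cong refl distr_PiM_component[symmetric] assms)
  finally show ?thesis
    by (subst indep_vars_iff_distr_eq_PiM'[OF assms(2)]) auto
qed

lemma distr_pair_snd:
  assumes "prob_space M" "prob_space P"
  shows "distr (M \<Otimes>\<^sub>M P) P snd = P"
proof -
  interpret M: prob_space M by fact
  interpret P: prob_space P by fact
  show ?thesis
  proof (rule measure_eqI)
    fix A assume "A \<in> sets (distr (M \<Otimes>\<^sub>M P) P snd)"
    then have A: "A \<in> sets P" by simp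
    then have "snd -` A \<inter> space (M \<Otimes>\<^sub>M P) = space M \<times> A"
      using sets.sets_into_space[OF A] by (auto simp: space_pair_measure)
    with A show "emeasure (distr (M \<Otimes>\<^sub>M P) P snd) A = emeasure P A"
      by (simp add: emeasure_distr P.emeasure_pair_measure_Times M.emeasure_space_1)
  qed simp
qed

section \<open>Gaussian random variables\<close>

context prob_space
begin

lemma gaussian_rv_moments:
  assumes "gaussian_rv M m v X"
  shows "X \<in> borel_measurable M"
    and "integrable M X" and "expectation X = m"
    and "integrable M (\<lambda>x. (X x - m)\<^sup>2)" and "expectation (\<lambda>x. (X x - m)\<^sup>2) = v"
proof -
  have X[measurable]: "X \<in> borel_measurable M" using assms by (simp add: gaussian_rv_def)
  then show "X \<in> borel_measurable M" .
  have "integrable M X \<and> expectation X = m \<and> integrable M (\<lambda>x. (X x - m)\<^sup>2) \<and> expectation (\<lambda>x. (X x - m)\<^sup>2) = v"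
  proof (cases "v = 0")
    case True
    with assms have ae: "AE x in M. X x = m" by (simp add: gaussian_rv_def)
    then have ae2: "AE x in M. (X x - m)\<^sup>2 = 0" by eventually_elim simp
    have "integrable M X \<longleftrightarrow> integrable M (\<lambda>_. m)" "expectation X = expectation (\<lambda>_. m)"
      by (rule integrable_cong_AE integral_cong_AE; use ae in simp)+
    moreover have "integrable M (\<lambda>x. (X x - m)\<^sup>2) \<longleftrightarrow> integrable M (\<lambda>_. 0::real)"
      "expectation (\<lambda>x. (X x - m)\<^sup>2) = expectation (\<lambda>_. 0)"
      by (rule integrable_cong_AE integral_cong_AE; use ae2 in simp)+
    ultimately show ?thesis using True by (simp add: prob_space)
  next
    case False
    with assms have v: "0 < sqrt v" "0 < v" and D: "distributed M lborel X (normal_density m (sqrt v))"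
      by (auto simp: gaussian_rv_def)
    have E: "expectation X = m" by (rule normal_distributed_expectation[OF v(1) D])
    moreover have "expectation (\<lambda>x. (X x - m)\<^sup>2) = v"
      using normal_distributed_variance[OF v(1) D] v E by simp
    moreover have "integrable M X"
      using distributed_integrable[OF D, of "\<lambda>x. x"] integrable_normal_moment_nz_1[OF v(1)] by simp
    moreover have "integrable M (\<lambda>x. (X x - m)\<^sup>2)"
      using distributed_integrable[OF D, of "\<lambda>x. (x - m)\<^sup>2"] integrable_normal_moment[OF v(1), of m 2] by simp
    ultimately show ?thesis by blast
  qed
  then show "integrable M X" "expectation X = m" "integrable M (\<lambda>x. (X x - m)\<^sup>2)"
    "expectation (\<lambda>x. (X x - m)\<^sup>2) = v" by auto
qed

lemma gaussian_rv_cong_AE: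
  assumes X: "gaussian_rv M m v X" and [measurable]: "Y \<in> borel_measurable M"
    and eq: "AE x in M. X x = Y x"
  shows "gaussian_rv M m v Y"
proof -
  have [measurable]: "X \<in> borel_measurable M" using X by (simp add: gaussian_rv_def)
  have "distr M lborel X = distr M lborel Y"
    by (rule distr_cong_AE) (use eq in auto)
  moreover have "(AE x in M. X x = m) \<longleftrightarrow> (AE x in M. Y x = m)"
    using eq by (auto elim: eventually_elim2)
  ultimately show ?thesis
    using X by (auto simp: gaussian_rv_def distributed_def)
qed

lemma gaussian_rv_const: "gaussian_rv M a 0 (\<lambda>_. a)"
  by (simp add: gaussian_rv_def)

lemma gaussian_rv_affine:
  assumes X: "gaussian_rv M m v X"
  shows "gaussian_rv M (a + c * m) (c\<^sup>2 * v) (\<lambda>x. a + c * X x)"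
proof -
  have [measurable]: "X \<in> borel_measurable M" using X by (simp add: gaussian_rv_def)
  show ?thesis
  proof (cases "c = 0 \<or> v = 0")
    case True
    with X have "AE x in M. a + c * X x = a + c * m"
      by (auto simp: gaussian_rv_def)
    with True show ?thesis by (auto simp: gaussian_rv_def)
  next
    case False
    with X have v: "0 < v" and D: "distributed M lborel X (normal_density m (sqrt v))"
      by (auto simp: gaussian_rv_def)
    have "distributed M lborel (\<lambda>x. a + c * X x) (normal_density (a + c * m) (\<bar>c\<bar> * sqrt v))"
      by (rule normal_density_affine[OF D]) (use v False in auto)
    with v False show ?thesis
      by (simp add: gaussian_rv_def real_sqrt_mult)
  qed
qed

text \<open>Degenerate summands are constants up to a null set, so they only shift the other summand.\<close>

lemma gaussian_rv_add:
  assumes X: "gaussian_rv M m v X" and Y: "gaussian_rv M n w Y"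
    and ind: "indep_var borel X borel Y"
  shows "gaussian_rv M (m + n) (v + w) (\<lambda>x. X x + Y x)"
proof -
  have [measurable]: "X \<in> borel_measurable M" "Y \<in> borel_measurable M"
    using X Y by (simp_all add: gaussian_rv_def)
  consider "v = 0" | "w = 0" | "0 < v" "0 < w" using X Y by (auto simp: gaussian_rv_def)
  then show ?thesis
  proof cases
    case 1
    then have "AE x in M. X x = m" using X by (simp add: gaussian_rv_def)
    then have "AE x in M. m + 1 * Y x = X x + Y x" by eventually_elim simp
    from gaussian_rv_cong_AE[OF gaussian_rv_affine[OF Y, of m 1] _ this] 1 show ?thesis by simp
  next
    case 2
    then have "AE x in M. Y x = n" using Y by (simp add: gaussian_rv_def)
    then have "AE x in M. n + 1 * X x = X x + Y x" by eventually_elim simp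
    from gaussian_rv_cong_AE[OF gaussian_rv_affine[OF X, of n 1] _ this] 2 show ?thesis
      by (simp add: add.commute)
  next
    case 3
    with X Y add_indep_normal[OF ind, of "sqrt v" "sqrt w" m n] show ?thesis
      by (auto simp: gaussian_rv_def)
  qed
qed

lemma gaussian_rv_sum:
  assumes "finite I" "indep_vars (\<lambda>_. borel) X I"
    and "\<And>i. i \<in> I \<Longrightarrow> gaussian_rv M (m i) (v i) (X i)"
  shows "gaussian_rv M (\<Sum>i\<in>I. m i) (\<Sum>i\<in>I. v i) (\<lambda>x. \<Sum>i\<in>I. X i x)"
  using assms
proof (induction I rule: finite_induct)
  case empty
  then show ?case using gaussian_rv_const[of 0] by simp
next
  case (insert i I)
  have "gaussian_rv M (\<Sum>i\<in>I. m i) (\<Sum>i\<in>I. v i) (\<lambda>x. \<Sum>i\<in>I. X i x)"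
    using insert by (intro insert.IH indep_vars_subset[OF insert.prems(1)]) auto
  from gaussian_rv_add[OF insert.prems(2) this indep_vars_sum[OF insert.hyps insert.prems(1)]]
  show ?case using insert.hyps by simp
qed

lemma gaussian_rv_lincomb:
  assumes "finite I" and X: "indep_vars (\<lambda>_. borel) X I" "\<And>i. i \<in> I \<Longrightarrow> gaussian_rv M (m i) (v i) (X i)"
  shows "gaussian_rv M (a + (\<Sum>i\<in>I. c i * m i)) (\<Sum>i\<in>I. (c i)\<^sup>2 * v i) (\<lambda>x. a + (\<Sum>i\<in>I. c i * X i x))"
proof -
  have "gaussian_rv M (\<Sum>i\<in>I. c i * m i) (\<Sum>i\<in>I. (c i)\<^sup>2 * v i) (\<lambda>x. \<Sum>i\<in>I. c i * X i x)"
  proof (rule gaussian_rv_sum[OF \<open>finite I\<close>])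
    show "indep_vars (\<lambda>_. borel) (\<lambda>i x. c i * X i x) I"
      by (rule indep_vars_compose2[OF X(1)]) simp
    show "gaussian_rv M (c i * m i) ((c i)\<^sup>2 * v i) (\<lambda>x. c i * X i x)" if "i \<in> I" for i
      using gaussian_rv_affine[OF X(2)[OF that], of 0 "c i"] by simp
  qed
  from gaussian_rv_affine[OF this, of a 1] show ?thesis by simp
qed

text \<open>By polarization the covariance is a quarter of the difference of the variances of the sum and of the
  difference, which are Gaussian with known variances.\<close>

lemma covariance_lincomb:
  assumes "finite I" and X: "indep_vars (\<lambda>_. borel) X I" "\<And>i. i \<in> I \<Longrightarrow> gaussian_rv M (m i) (v i) (X i)"
  shows "covariance M (\<lambda>x. \<Sum>i\<in>I. c i * X i x) (\<lambda>x. \<Sum>i\<in>I. d i * X i x) = (\<Sum>i\<in>I. c i * d i * v i)"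
proof -
  define L where "L c x = (\<Sum>i\<in>I. c i * X i x)" for c x
  define \<mu> where "\<mu> c = (\<Sum>i\<in>I. c i * m i)" for c
  define V where "V c = (\<Sum>i\<in>I. (c i)\<^sup>2 * v i)" for c
  have G: "gaussian_rv M (\<mu> c) (V c) (L c)" for c
    using gaussian_rv_lincomb[OF assms, of 0 c] by (simp add: L_def[abs_def] \<mu>_def V_def)
  note mom = gaussian_rv_moments[OF G]
  let ?p = "\<lambda>i. c i + d i" and ?q = "\<lambda>i. c i - d i"
  have "(L c x - \<mu> c) * (L d x - \<mu> d) = ((L ?p x - \<mu> ?p)\<^sup>2 - (L ?q x - \<mu> ?q)\<^sup>2) / 4" for x
    by (simp add: L_def \<mu>_def distrib_right left_diff_distrib sum.distrib sum_subtractf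
        power2_eq_square) (simp add: algebra_simps)
  then have "covariance M (L c) (L d) = expectation (\<lambda>x. ((L ?p x - \<mu> ?p)\<^sup>2 - (L ?q x - \<mu> ?q)\<^sup>2) / 4)"
    unfolding covariance_def mom(3) by (intro Bochner_Integration.integral_cong refl)
  also have "\<dots> = (V ?p - V ?q) / 4"
    by (simp add: mom(4,5))
  also have "\<dots> = (\<Sum>i\<in>I. c i * d i * v i)"
    unfolding V_def sum_subtractf[symmetric] sum_divide_distrib
    by (intro sum.cong refl) (simp add: power2_eq_square algebra_simps)
  finally show ?thesis by (simp add: L_def[abs_def])
qed

lemma distr_standard_gaussian:
  assumes "gaussian_rv M 0 1 X"
  shows "distr M borel X = std_normal_distribution"
proof -
  have "distr M lborel X = density lborel std_normal_density"
    using assms by (simp add: gaussian_rv_def distributed_def)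
  moreover have "distr M lborel X = distr M borel X"
    by (rule distr_cong) auto
  ultimately show ?thesis by simp
qed

lemma distr_sum_squares_standard_gaussian:
  assumes "finite K" "K \<noteq> {}" "indep_vars (\<lambda>_. borel) X K"
    and X: "\<And>k. k \<in> K \<Longrightarrow> distr M borel (X k) = std_normal_distribution"
  shows "distr M borel (\<lambda>x. \<Sum>k\<in>K. (X k x)\<^sup>2) = chi_square (card K)"
proof -
  let ?n = "card K"
  obtain f where f: "bij_betw f {..<?n} K"
    using ex_bij_betw_nat_finite[OF \<open>finite K\<close>] by (auto simp: atLeast0LessThan)
  have ne: "{..<?n} \<noteq> {}"
    using assms(1,2) by (simp add: lessThan_empty_iff)
  have ind: "indep_vars (\<lambda>_. borel) (\<lambda>i. X (f i)) {..<?n}"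
    by (rule indep_vars_inj[OF assms(3)]) (use f in \<open>auto simp: bij_betw_def\<close>)
  then have rv[measurable]: "i \<in> {..<?n} \<Longrightarrow> X (f i) \<in> borel_measurable M" for i
    by (simp add: indep_vars_def2)
  let ?P = "PiM {..<?n} (\<lambda>_. borel :: real measure)"
  have rvP: "(\<lambda>x. \<lambda>i\<in>{..<?n}. X (f i) x) \<in> measurable M ?P"
    by (intro measurable_restrict rv)
  have sq: "(\<lambda>y. \<Sum>i<?n. (y i)\<^sup>2) \<in> borel_measurable ?P"
    by measurable
  have "distr M ?P (\<lambda>x. \<lambda>i\<in>{..<?n}. X (f i) x) = PiM {..<?n} (\<lambda>i. distr M borel (X (f i)))"
    using ind by (subst (asm) indep_vars_iff_distr_eq_PiM'[OF ne rv]) auto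
  also have "\<dots> = PiM {..<?n} (\<lambda>_. std_normal_distribution)"
    by (intro PiM_cong refl X) (use f in \<open>auto simp: bij_betw_def\<close>)
  finally have "chi_square ?n = distr (distr M ?P (\<lambda>x. \<lambda>i\<in>{..<?n}. X (f i) x)) borel (\<lambda>y. \<Sum>i<?n. (y i)\<^sup>2)"
    by (simp add: chi_square_def)
  also have "\<dots> = distr M borel (\<lambda>x. \<Sum>i<?n. (X (f i) x)\<^sup>2)"
    by (subst distr_distr[OF sq rvP]) (auto intro!: distr_cong simp: o_def)
  also have "(\<lambda>x. \<Sum>i<?n. (X (f i) x)\<^sup>2) = (\<lambda>x. \<Sum>k\<in>K. (X k x)\<^sup>2)"
    by (intro ext sum.reindex_bij_betw[OF f])
  finally show ?thesis by simp
qed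

end

section \<open>Fourier coefficients of the noisy curves\<close>

lemma C1_curve_continuous: "C1_curve f \<Longrightarrow> continuous_on {-pi..pi} f"
  unfolding C1_curve_def by (auto intro: continuous_on_vector_derivative)

text \<open>A countable dense set of parameters needs only countably many exceptional null sets; outside them the
  series converges to the path on the whole dense set.\<close>

lemma AE_fcoef_noise:
  assumes M: "prob_space M" and noise: "noise_model M T \<sigma> A B N"
    and t: "t \<le> T" and m: "m \<in> modes J"
  shows "AE \<omega> in M. fcoef (\<lambda>\<theta>. N t \<theta> \<omega>) m $ i = (if fst m then A else B) t (snd m) i \<omega>"
proof -
  interpret prob_space M by fact
  obtain \<epsilon> where \<epsilon>: "0 < \<epsilon>" "summable (\<lambda>j. real j powr (2 + \<epsilon>) * (\<sigma> j)\<^sup>2)"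
    using noise by (auto simp: noise_model_def)
  have gauss: "gaussian_rv M 0 ((\<sigma> j)\<^sup>2) (A t j i)" "gaussian_rv M 0 ((\<sigma> j)\<^sup>2) (B t j i)" for j
    using noise t by (auto simp: noise_model_def)
  have AE_A: "AE \<omega> in M. summable (\<lambda>j. \<bar>A t j i \<omega>\<bar>)" and AE_B: "AE \<omega> in M. summable (\<lambda>j. \<bar>B t j i \<omega>\<bar>)"
    using gaussian_rv_moments[OF gauss(1)] gaussian_rv_moments[OF gauss(2)]
    by (auto intro!: AE_summable_if_second_moments[OF _ _ _ \<epsilon>])
  obtain D where D: "countable D" "D \<subseteq> {-pi..pi}" "{-pi..pi} \<subseteq> closure D"
    using separable[of "{-pi..pi}"] by metis
  have "AE \<omega> in M. \<forall>\<theta>\<in>D. (\<lambda>j. A t j i \<omega> * cos (real j * \<theta>) + B t j i \<omega> * sin (real j * \<theta>)) sums (N t \<theta> \<omega> $ i)"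
    using noise t D(1,2) by (intro AE_ball_countable') (auto simp: noise_model_def)
  with AE_A AE_B AE_space show ?thesis
  proof eventually_elim
    case (elim \<omega>)
    define a where "a m = (if fst m then A else B) t (snd m) i \<omega>" for m
    have cont: "continuous_on {-pi..pi} (\<lambda>\<theta>. N t \<theta> \<omega>)"
      using noise t elim(3) by (intro C1_curve_continuous) (auto simp: noise_model_def)
    have "fcoef (\<lambda>\<theta>. N t \<theta> \<omega> $ i) m = a m"
    proof (rule fcoef_of_summable_series[OF _ _ D(2,3) _ m])
      show "summable (\<lambda>j. \<bar>a (True, j)\<bar> + \<bar>a (False, j)\<bar>)"
        unfolding a_def using summable_add[OF elim(1,2)] by simp
      show "(\<lambda>j. a (True, j) * mode (True, j) \<theta> + a (False, j) * mode (False, j) \<theta>) sums (N t \<theta> \<omega> $ i)"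
        if "\<theta> \<in> D" for \<theta>
        using elim(4) that by (simp add: a_def mode_def)
    qed (intro continuous_intros cont)
    then show ?case
      using fcoef_linear_image[OF bounded_linear_vec_nth cont m, of i] by (simp add: a_def)
  qed
qed

definition mean_fcoef :: "nat \<Rightarrow> (nat \<Rightarrow> real \<Rightarrow> 'w \<Rightarrow> real ^ 2) \<Rightarrow> bool \<times> nat \<Rightarrow> 'w \<Rightarrow> real ^ 2" where
  "mean_fcoef T X m \<omega> = (1 / real (T + 1)) *\<^sub>R (\<Sum>t\<le>T. fcoef (\<lambda>\<theta>. X t \<theta> \<omega>) m)"

lemma Gamma_hat_eq_trig_sum:
  "Gamma_hat T J X \<theta> \<omega> = (\<Sum>m\<in>modes J. mode m \<theta> *\<^sub>R mean_fcoef T X m \<omega>)"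
  unfolding Gamma_hat_def trig_poly_eq_sum_modes mean_fcoef_def mu_hat_def nu_hat_def fcoef_def
  by (intro sum.cong refl) auto

text \<open>The coordinates of the averaged coefficients are averages over \<open>t\<close> of disjoint groups of independent
  Gaussian coefficients of the noise. Averaging \<open>T + 1\<close> of them divides the variance by \<open>T + 1\<close>.\<close>

lemma mean_fcoef_independent_gaussian:
  fixes \<Gamma> :: "real \<Rightarrow> real ^ 2"
  assumes M: "prob_space M" and \<Gamma>: "continuous_on {-pi..pi} \<Gamma>" and noise: "noise_model M T \<sigma> A B N"
    and X: "\<And>t \<theta> \<omega>. t \<le> T \<Longrightarrow> \<theta> \<in> {-pi..pi} \<Longrightarrow> \<omega> \<in> space M \<Longrightarrow> X t \<theta> \<omega> = \<Gamma> \<theta> + N t \<theta> \<omega>"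
  shows "prob_space.indep_vars M (\<lambda>_. borel) (\<lambda>(m, i) \<omega>. mean_fcoef T X m \<omega> $ i) (modes J \<times> UNIV)"
    and "m \<in> modes J \<Longrightarrow>
           gaussian_rv M (fcoef \<Gamma> m $ i) ((\<sigma> (snd m))\<^sup>2 / real (T + 1)) (\<lambda>\<omega>. mean_fcoef T X m \<omega> $ i)"
proof -
  interpret prob_space M by fact
  let ?W = "\<lambda>(is_cos, t, j, i). if is_cos then A t j i else B t j i"
  let ?I = "(UNIV :: bool set) \<times> {..T} \<times> (UNIV :: nat set) \<times> (UNIV :: 2 set)"
  \<comment> \<open>\<open>G\<close> holds the coefficients of the noise paths and equals the given family only almost surely; \<open>f\<close> translates between the indexings.\<close>
  define G where "G = (\<lambda>(m, t, i) \<omega>. fcoef (\<lambda>\<theta>. N t \<theta> \<omega>) m $ i)"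
  define Q where "Q = modes J \<times> {..T} \<times> (UNIV :: 2 set)"
  define f where "f = (\<lambda>(m :: bool \<times> nat, t :: nat, i :: 2). (fst m, t, snd m, i))"
  have cont: "continuous_on {-pi..pi} (\<lambda>\<theta>. N t \<theta> \<omega>)" if "t \<le> T" "\<omega> \<in> space M" for t \<omega>
    using noise that by (intro C1_curve_continuous) (auto simp: noise_model_def)
  have G_meas: "G q \<in> borel_measurable M" if "q \<in> Q" for q
    using that noise cont
    by (auto simp: G_def Q_def noise_model_def intro!: borel_measurable_fcoef[where J = J])
  have G_eq: "AE \<omega> in M. ?W (f q) \<omega> = G q \<omega>" if "q \<in> Q" for q
  proof -
    obtain m t i where q: "q = (m, t, i)" by (cases q)
    with that have "t \<le> T" "m \<in> modes J" by (auto simp: Q_def)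
    from AE_fcoef_noise[OF M noise this, of i] show ?thesis
      by eventually_elim (simp add: q G_def f_def)
  qed
  have "indep_vars (\<lambda>_. borel) (\<lambda>q. ?W (f q)) Q"
  proof (rule indep_vars_inj)
    show "indep_vars (\<lambda>_. borel) ?W ?I"
      using noise by (simp add: noise_model_def)
    show "inj_on f Q" "f ` Q \<subseteq> ?I"
      by (auto simp: f_def Q_def inj_on_def)
  qed
  then have G_indep: "indep_vars (\<lambda>_. borel) G Q"
    by (rule indep_vars_cong_AE) (use G_meas G_eq in auto)
  have G_gauss: "gaussian_rv M 0 ((\<sigma> (snd (fst q)))\<^sup>2) (G q)" if "q \<in> Q" for q
  proof (rule gaussian_rv_cong_AE[OF _ G_meas[OF that] G_eq[OF that]])
    show "gaussian_rv M 0 ((\<sigma> (snd (fst q)))\<^sup>2) (?W (f q))"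
      using noise that by (cases q) (auto simp: noise_model_def f_def Q_def)
  qed
  have split: "mean_fcoef T X m \<omega> $ i = fcoef \<Gamma> m $ i + (\<Sum>t\<le>T. 1 / real (T + 1) * G (m, t, i) \<omega>)"
    if m: "m \<in> modes J" and \<omega>: "\<omega> \<in> space M" for m i \<omega>
  proof -
    have "fcoef (\<lambda>\<theta>. X t \<theta> \<omega>) m = fcoef \<Gamma> m + fcoef (\<lambda>\<theta>. N t \<theta> \<omega>) m" if "t \<le> T" for t
    proof -
      have "fcoef (\<lambda>\<theta>. X t \<theta> \<omega>) m = fcoef (\<lambda>\<theta>. \<Gamma> \<theta> + N t \<theta> \<omega>) m"
        by (intro fcoef_cong X that \<omega>)
      also have "\<dots> = fcoef \<Gamma> m + fcoef (\<lambda>\<theta>. N t \<theta> \<omega>) m"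
        by (intro fcoef_add[OF \<Gamma> cont m] that \<omega>)
      finally show ?thesis .
    qed
    then have "mean_fcoef T X m \<omega> =
        (1 / real (T + 1)) *\<^sub>R (\<Sum>t\<le>T. fcoef \<Gamma> m + fcoef (\<lambda>\<theta>. N t \<theta> \<omega>) m)"
      unfolding mean_fcoef_def by (intro arg_cong2[where f = scaleR] sum.cong) auto
    also have "\<dots> $ i = fcoef \<Gamma> m $ i + 1 / real (T + 1) * (\<Sum>t\<le>T. G (m, t, i) \<omega>)"
      by (simp add: G_def sum.distrib distrib_left sum_component sum_constant_scaleR del: sum_constant)
    finally show ?thesis by (simp add: sum_distrib_left)
  qed
  show "indep_vars (\<lambda>_. borel) (\<lambda>(m, i) \<omega>. mean_fcoef T X m \<omega> $ i) (modes J \<times> UNIV)"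
    by (rule indep_vars_grouped[OF G_indep, where K = "\<lambda>(m, i). {m} \<times> {..T} \<times> {i}"
          and g = "\<lambda>(m, i) x. fcoef \<Gamma> m $ i + (\<Sum>t\<le>T. 1 / real (T + 1) * x (m, t, i))"])
       (auto simp: Q_def disjoint_family_on_def split)
  assume m: "m \<in> modes J"
  have "gaussian_rv M (fcoef \<Gamma> m $ i + (\<Sum>t\<le>T. 1 / real (T + 1) * 0))
          (\<Sum>t\<le>T. (1 / real (T + 1))\<^sup>2 * (\<sigma> (snd m))\<^sup>2)
          (\<lambda>\<omega>. fcoef \<Gamma> m $ i + (\<Sum>t\<le>T. 1 / real (T + 1) * G (m, t, i) \<omega>))"
  proof (rule gaussian_rv_lincomb)
    show "indep_vars (\<lambda>_. borel) (\<lambda>t. G (m, t, i)) {..T}"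
      by (rule indep_vars_inj[OF G_indep]) (use m in \<open>auto simp: Q_def inj_on_def\<close>)
    show "gaussian_rv M 0 ((\<sigma> (snd m))\<^sup>2) (G (m, t, i))" if "t \<in> {..T}" for t
      using G_gauss[of "(m, t, i)"] that m by (simp add: Q_def)
  qed simp
  also have "(\<Sum>t\<le>T. (1 / real (T + 1))\<^sup>2 * (\<sigma> (snd m))\<^sup>2) = (\<sigma> (snd m))\<^sup>2 / real (T + 1)"
  proof -
    have "n * ((1 / n)\<^sup>2 * s) = s / n" if "n \<noteq> 0" for n s :: real
      using that by (simp add: power2_eq_square)
    from this[of "real (T + 1)"] show ?thesis
      by (simp only: sum_constant card_atMost Suc_eq_plus1)
  qed
  finally have *: "gaussian_rv M (fcoef \<Gamma> m $ i) ((\<sigma> (snd m))\<^sup>2 / real (T + 1))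
          (\<lambda>\<omega>. fcoef \<Gamma> m $ i + (\<Sum>t\<le>T. 1 / real (T + 1) * G (m, t, i) \<omega>))"
    by simp
  have "(\<lambda>\<omega>. mean_fcoef T X m \<omega> $ i) \<in> borel_measurable M"
    using gaussian_rv_moments(1)[OF *] by (subst measurable_cong[OF split[OF m]])
  with * show "gaussian_rv M (fcoef \<Gamma> m $ i) ((\<sigma> (snd m))\<^sup>2 / real (T + 1)) (\<lambda>\<omega>. mean_fcoef T X m \<omega> $ i)"
    by (rule gaussian_rv_cong_AE) (auto simp: split[OF m])
qed

section \<open>Trigonometric polynomials with Gaussian coefficients\<close>

text \<open>Trigonometric polynomials with independent Gaussian coefficients whose variance depends on the
  frequency only: cosine and sine coefficients share it, and so do all components.\<close>

locale gaussian_trig_sum = prob_space M for M :: "'w measure" +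
  fixes J :: nat and E :: "bool \<times> nat \<Rightarrow> 'w \<Rightarrow> real ^ 'n" and c :: "bool \<times> nat \<Rightarrow> real ^ 'n"
    and v :: "nat \<Rightarrow> real"
  assumes indep: "indep_vars (\<lambda>_. borel) (\<lambda>(m, i) \<omega>. E m \<omega> $ i) (modes J \<times> UNIV)"
    and gaussian: "\<And>m i. m \<in> modes J \<Longrightarrow> gaussian_rv M (c m $ i) (v (snd m)) (\<lambda>\<omega>. E m \<omega> $ i)"
begin

definition process :: "real \<Rightarrow> 'w \<Rightarrow> real ^ 'n" where
  "process \<theta> \<omega> = (\<Sum>m\<in>modes J. mode m \<theta> *\<^sub>R E m \<omega>)"

lemma gaussian_coord: "k \<in> modes J \<times> UNIV \<Longrightarrow>
    gaussian_rv M (c (fst k) $ snd k) (v (snd (fst k))) ((\<lambda>(m, i) \<omega>. E m \<omega> $ i) k)"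
  using gaussian by (cases k) auto

lemma gaussian_rv_linear_functional:
  "\<exists>m w. gaussian_rv M m w (\<lambda>\<omega>. \<Sum>k\<in>modes J \<times> UNIV. d k * E (fst k) \<omega> $ snd k)"
  using gaussian_rv_lincomb[OF _ indep gaussian_coord, of 0 d] by (auto simp: split_beta)

lemma process_component: "process \<theta> \<omega> $ i = (\<Sum>k\<in>modes J \<times> UNIV. (if snd k = i then mode (fst k) \<theta> else 0) * E (fst k) \<omega> $ snd k)"
  unfolding sum.cartesian_product' process_def
  by (simp add: if_distrib[where f = "\<lambda>x. x * _"] sum_component cong: if_cong)

lemma measurable_process [measurable]: "process \<theta> \<in> borel_measurable M"
proof -
  have E: "(\<lambda>\<omega>. E m \<omega> $ i) \<in> borel_measurable M" if "m \<in> modes J" for m i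
    using gaussian_rv_moments(1)[OF gaussian[OF that]] .
  have "(\<lambda>\<omega>. process \<theta> \<omega> $ i) \<in> borel_measurable M" for i
    unfolding process_def using E by simp
  then show ?thesis
    by (intro borel_measurable_euclidean_space[THEN iffD2])
       (auto simp: Basis_vec_def inner_axis)
qed

lemma process_is_gaussian: "gaussian_process M I process"
  unfolding gaussian_process_def
proof (intro conjI ballI allI impI measurable_process)
  fix S :: "real set" and w :: "real \<Rightarrow> real ^ 'n"
  assume "finite S \<and> S \<subseteq> I"
  have "(\<Sum>\<theta>\<in>S. w \<theta> \<bullet> process \<theta> \<omega>) =
        (\<Sum>k\<in>modes J \<times> UNIV. (\<Sum>\<theta>\<in>S. w \<theta> $ snd k * mode (fst k) \<theta>) * E (fst k) \<omega> $ snd k)" for \<omega>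
  proof -
    have "w \<theta> \<bullet> process \<theta> \<omega> = (\<Sum>k\<in>modes J \<times> UNIV. w \<theta> $ snd k * mode (fst k) \<theta> * E (fst k) \<omega> $ snd k)" for \<theta>
      unfolding inner_vec_def sum.cartesian_product'
      by (simp add: process_def sum_distrib_left mult.assoc) (rule sum.swap)
    then show ?thesis
      unfolding sum_distrib_right by (simp add: sum.swap[of _ S])
  qed
  then show "\<exists>m x. gaussian_rv M m x (\<lambda>\<omega>. \<Sum>\<theta>\<in>S. w \<theta> \<bullet> process \<theta> \<omega>)"
    using gaussian_rv_linear_functional by simp
qed

text \<open>Equal variances of the cosine and the sine coefficient turn \<open>cos (j\<theta>) cos (j\<eta>) + sin (j\<theta>) sin (j\<eta>)\<close>
  into \<open>cos (j(\<eta> - \<theta>))\<close>, which is the reason for stationarity. Distinct components share no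
  coefficient.\<close>

lemma covariance_process:
  "covariance M (\<lambda>\<omega>. process \<theta> \<omega> $ i) (\<lambda>\<omega>. process \<eta> \<omega> $ k) = (if i = k then \<Sum>j\<le>J. v j * cos (real j * (\<eta> - \<theta>)) else 0)"
proof -
  have "covariance M (\<lambda>\<omega>. process \<theta> \<omega> $ i) (\<lambda>\<omega>. process \<eta> \<omega> $ k) =
      (\<Sum>p\<in>modes J \<times> UNIV. (if snd p = i then mode (fst p) \<theta> else 0) * (if snd p = k then mode (fst p) \<eta> else 0) * v (snd (fst p)))"
    unfolding process_component
    using covariance_lincomb[OF _ indep gaussian_coord, of "\<lambda>p. if snd p = i then mode (fst p) \<theta> else 0"
        "\<lambda>p. if snd p = k then mode (fst p) \<eta> else 0"]
    by (simp add: split_beta)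
  also have "\<dots> = (\<Sum>m\<in>modes J. \<Sum>l\<in>UNIV. if l = i then (if i = k then mode m \<theta> * mode m \<eta> * v (snd m) else 0) else 0)"
    unfolding sum.cartesian_product by (intro sum.cong refl) auto
  also have "\<dots> = (if i = k then \<Sum>m\<in>modes J. mode m \<theta> * mode m \<eta> * v (snd m) else 0)"
    by simp
  also have "(\<Sum>m\<in>modes J. mode m \<theta> * mode m \<eta> * v (snd m)) = (\<Sum>j\<le>J. v j * cos (real j * (\<eta> - \<theta>)))"
  proof -
    have "{..J} = insert 0 {1..J}" by auto
    then show ?thesis
      by (simp add: sum_modes mode_def right_diff_distrib cos_diff algebra_simps)
  qed
  finally show ?thesis .
qed

lemma process_is_covariance_stationary: "covariance_stationary M I process"
  unfolding covariance_stationary_def covariance_process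
  by (rule exI[of _ "\<lambda>i k x. if i = k then \<Sum>j\<le>J. v j * cos (real j * x) else 0"]) simp

lemma process_is_cyclic: "cyclic_process M process"
  by (simp add: cyclic_process_def process_def mode_periodic)

lemma process_has_independent_components: "independent_components M I process"
  unfolding independent_components_def
proof (rule indep_vars_grouped[OF indep, where K = "\<lambda>i. modes J \<times> {i}"
      and g = "\<lambda>i x. \<lambda>\<theta>\<in>I. \<Sum>m\<in>modes J. mode m \<theta> * x (m, i)"])
  show "(\<lambda>x. \<lambda>\<theta>\<in>I. \<Sum>m\<in>modes J. mode m \<theta> * x (m, i)) \<in>
      measurable (PiM (modes J \<times> {i}) (\<lambda>_. borel)) (PiM I (\<lambda>_. borel))" for i :: 'n
    by (intro measurable_restrict borel_measurable_sum borel_measurable_times measurable_component_singleton) auto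
qed (auto simp: disjoint_family_on_def process_def)

lemma expectation_process: "expectation (process \<theta>) = (\<Sum>m\<in>modes J. mode m \<theta> *\<^sub>R c m)"
proof -
  have E: "has_bochner_integral M (E m) (c m)" if "m \<in> modes J" for m
  proof -
    have "has_bochner_integral M (\<lambda>\<omega>. \<Sum>i\<in>UNIV. E m \<omega> $ i *\<^sub>R axis i 1) (\<Sum>i\<in>UNIV. c m $ i *\<^sub>R axis i (1::real))"
      using gaussian_rv_moments(2,3)[OF gaussian[OF that]]
      by (intro has_bochner_integral_sum has_bochner_integral_scaleR_left) (auto simp: has_bochner_integral_iff)
    then show ?thesis by (simp add: scalar_mult_eq_scaleR[symmetric] basis_expansion)
  qed
  have "has_bochner_integral M (process \<theta>) (\<Sum>m\<in>modes J. mode m \<theta> *\<^sub>R c m)"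
    unfolding process_def[abs_def] by (intro has_bochner_integral_sum has_bochner_integral_scaleR_right E)
  then show ?thesis by (rule has_bochner_integral_integral_eq)
qed

end

section \<open>The integrated squared error\<close>

text \<open>Parseval's identity for the error: up to \<open>J\<close> its coefficients are \<open>e - fcoef \<Gamma>\<close>, beyond \<open>J\<close> they are those
  of \<open>-\<Gamma>\<close>. Stated as convergence of the tail, it also contains the summability of the squared
  coefficients of \<open>\<Gamma>\<close>.\<close>

lemma integrated_squared_error_trig_sum:
  fixes \<Gamma> :: "real \<Rightarrow> real ^ 2"
  assumes \<Gamma>: "continuous_on {-pi..pi} \<Gamma>" "\<Gamma> (-pi) = \<Gamma> pi"
  shows "(\<lambda>j. (norm (fourier_cos \<Gamma> (j + (J + 1))))\<^sup>2 + (norm (fourier_sin \<Gamma> (j + (J + 1))))\<^sup>2) sums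
     (integrated_squared_error (\<lambda>\<theta>. \<Sum>m\<in>modes J. mode m \<theta> *\<^sub>R e m) \<Gamma>
        - (\<Sum>m\<in>modes J. mode_weight m * (norm (e m - fcoef \<Gamma> m))\<^sup>2))"
    (is "?tail sums (?ISE - ?S)")
proof -
  define p where "p \<theta> = (\<Sum>m\<in>modes J. mode m \<theta> *\<^sub>R e m)" for \<theta>
  define d where "d \<theta> = p \<theta> - \<Gamma> \<theta>" for \<theta>
  let ?g = "\<lambda>m. mode_weight m * (norm (fcoef d m))\<^sup>2"
  have p: "continuous_on {-pi..pi} p"
    unfolding p_def by (intro continuous_intros)
  have coef: "fcoef d m = (if m \<in> modes J then e m else 0) - fcoef \<Gamma> m" if "m \<in> modes n" for m n
    unfolding d_def fcoef_diff[OF p \<Gamma>(1) that] unfolding p_def fcoef_trig_sum[OF that] ..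
  have "(\<lambda>n. sum ?g (modes n)) \<longlonglongrightarrow> ?ISE"
    unfolding integrated_squared_error_def p_def[symmetric] d_def[symmetric]
    by (rule parseval) (use \<Gamma> p in \<open>auto simp: d_def p_def mode_periodic intro!: continuous_intros\<close>)
  then have "(\<lambda>k. sum ?g (modes (k + J))) \<longlonglongrightarrow> ?ISE"
    by (rule LIMSEQ_ignore_initial_segment)
  moreover have "sum ?g (modes (k + J)) = (\<Sum>j<k. ?tail j) + ?S" for k
  proof -
    have "sum ?g (modes J) = ?S"
      by (intro sum.cong refl) (simp add: coef)
    moreover have "sum ?g (modes (k + J)) = sum ?g (modes J) + (\<Sum>j<k. ?tail j)"
    proof (induction k)
      case (Suc k)
      have "?g (b, Suc (k + J)) = (norm (fcoef \<Gamma> (b, Suc (k + J))))\<^sup>2" for b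
        using coef[of "(b, Suc (k + J))" "Suc (k + J)"] by (simp add: mem_modes_iff mode_weight_def)
      from this[of True] this[of False] Suc show ?case
        by (simp add: sum_modes fcoef_def)
    qed simp
    ultimately show ?thesis by simp
  qed
  ultimately have "(\<lambda>k. (\<Sum>j<k. ?tail j) + ?S) \<longlonglongrightarrow> ?ISE" by simp
  from tendsto_diff[OF this tendsto_const[of ?S]] show ?thesis
    by (simp add: sums_def)
qed

text \<open>The modes are grouped by frequency. Frequency \<open>0\<close> has one mode with two components; every other
  frequency has two modes and therefore four coordinates.\<close>

lemma (in prob_space) weighted_chi_square_sum_standard_gaussian:
  assumes indep: "indep_vars (\<lambda>_. borel) S (modes J \<times> (UNIV :: 2 set))"
    and std: "\<And>k. k \<in> modes J \<times> UNIV \<Longrightarrow> distr M borel (S k) = std_normal_distribution"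
  shows "weighted_chi_square_sum M T J \<sigma>
     (\<lambda>\<omega>. \<Sum>m\<in>modes J. mode_weight m * ((\<sigma> (snd m))\<^sup>2 / real (T + 1) * (\<Sum>i\<in>UNIV. (S (m, i) \<omega>)\<^sup>2)))"
proof -
  define K where "K j = (if j = 0 then {True} else UNIV) \<times> {j} \<times> (UNIV :: 2 set)" for j :: nat
  define L where "L j = (\<lambda>(b, j, i). ((b, j), i)) ` K j" for j
  define Z where "Z j \<omega> = (\<Sum>k\<in>L j. (S k \<omega>)\<^sup>2)" for j \<omega>
  have LI: "L j \<subseteq> modes J \<times> UNIV" if "j \<in> {..J}" for j
    using that by (auto simp: L_def K_def mem_modes_iff)
  have fin: "finite (L j)" and ne: "L j \<noteq> {}" for j
    by (auto simp: L_def K_def)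
  have card: "card (L j) = (if j = 0 then 2 else 4)" for j
    unfolding L_def by (subst card_image) (auto simp: K_def inj_on_def card_cartesian_product)
  have "indep_vars (\<lambda>_. borel) Z {..J}"
  proof (rule indep_vars_grouped[OF indep LI])
    show "disjoint_family_on L {..J}" by (auto simp: disjoint_family_on_def L_def K_def)
    show "(\<lambda>x. \<Sum>k\<in>L j. (x k :: real)\<^sup>2) \<in> borel_measurable (PiM (L j) (\<lambda>_. borel))" for j
      by (intro borel_measurable_sum borel_measurable_power measurable_component_singleton)
  qed (simp_all add: Z_def)
  moreover have "distr M borel (Z j) = chi_square (if j = 0 then 2 else 4)" if "j \<in> {..J}" for j
    unfolding Z_def[abs_def] card[symmetric]
    by (intro distr_sum_squares_standard_gaussian fin ne indep_vars_subset[OF indep] LI std) (use LI that in auto)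
  moreover have "(\<Sum>m\<in>modes J. mode_weight m * ((\<sigma> (snd m))\<^sup>2 / real (T + 1) * (\<Sum>i\<in>UNIV. (S (m, i) \<omega>)\<^sup>2))) =
      1 / real (T + 1) * (2 * (\<sigma> 0)\<^sup>2 * Z 0 \<omega> + (\<Sum>j = 1..J. (\<sigma> j)\<^sup>2 * Z j \<omega>))" for \<omega>
  proof -
    have "Z j \<omega> = (\<Sum>b\<in>(if j = 0 then {True} else UNIV). \<Sum>i\<in>UNIV. (S ((b, j), i) \<omega>)\<^sup>2)" for j
      unfolding Z_def L_def
      by (subst sum.reindex) (auto simp: K_def inj_on_def sum.cartesian_product')
    then have Z0: "Z 0 \<omega> = (\<Sum>i\<in>UNIV. (S ((True, 0), i) \<omega>)\<^sup>2)"
      and Z: "\<And>j. j \<in> {1..J} \<Longrightarrow> Z j \<omega> = (\<Sum>i\<in>UNIV. (S ((True, j), i) \<omega>)\<^sup>2) + (\<Sum>i\<in>UNIV. (S ((False, j), i) \<omega>)\<^sup>2)"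
      by (auto simp: UNIV_bool)
    let ?g = "\<lambda>m. mode_weight m * ((\<sigma> (snd m))\<^sup>2 / real (T + 1) * (\<Sum>i\<in>UNIV. (S (m, i) \<omega>)\<^sup>2))"
    have "?g (True, j) + ?g (False, j) = 1 / real (T + 1) * ((\<sigma> j)\<^sup>2 * Z j \<omega>)" if "j \<in> {1..J}" for j
      using that unfolding Z[OF that] by (simp add: mode_weight_def distrib_left add_divide_distrib)
    then have "(\<Sum>j = 1..J. ?g (True, j) + ?g (False, j)) = 1 / real (T + 1) * (\<Sum>j = 1..J. (\<sigma> j)\<^sup>2 * Z j \<omega>)"
      unfolding sum_distrib_left by (rule sum.cong[OF refl])
    moreover have "?g (True, 0) = 1 / real (T + 1) * (2 * (\<sigma> 0)\<^sup>2 * Z 0 \<omega>)"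
      by (simp add: Z0 mode_weight_def)
    ultimately show ?thesis
      unfolding sum_modes distrib_left by simp
  qed
  ultimately show ?thesis
    unfolding weighted_chi_square_sum_def by (intro exI[of _ Z]) auto
qed

lemma exists_standard_gaussian_sequence:
  obtains P :: "(nat \<Rightarrow> real) measure" where "prob_space P"
    "prob_space.indep_vars P (\<lambda>_. borel) (\<lambda>i x. x i) UNIV"
    "\<And>i. distr P borel (\<lambda>x. x i) = std_normal_distribution"
proof -
  let ?P = "PiM UNIV (\<lambda>_::nat. std_normal_distribution)"
  have std: "prob_space std_normal_distribution" by (intro prob_space_normal_density) simp
  have P: "prob_space ?P" by (intro prob_space_PiM std)
  interpret prob_space ?P by fact
  have "indep_vars (\<lambda>_. std_normal_distribution) (\<lambda>i x. x i) UNIV"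
    by (intro indep_vars_PiM_coordinates std) auto
  then have indep: "indep_vars (\<lambda>_. borel) (\<lambda>i x. x i) UNIV"
    by (rule indep_vars_compose2[where Y = "\<lambda>_ x. x"]) simp
  have "distr ?P borel (\<lambda>x. x i) = std_normal_distribution" for i
  proof -
    have "distr ?P borel (\<lambda>x. x i) = distr ?P std_normal_distribution (\<lambda>x. x i)"
      by (rule distr_cong) auto
    then show ?thesis using distr_PiM_component[of UNIV "\<lambda>_. std_normal_distribution" i] std by simp
  qed
  with P indep show ?thesis by (rule that)
qed

context gaussian_trig_sum
begin

lemma standardized_coord:
  assumes "m \<in> modes J" "s \<noteq> 0" "v (snd m) = s\<^sup>2"
  shows "gaussian_rv M 0 1 (\<lambda>\<omega>. (E m \<omega> $ i - c m $ i) / s)"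
  using gaussian_rv_affine[OF gaussian[OF assms(1), of i], of "- (c m $ i) / s" "1 / s"] assms(2,3)
  by (simp add: diff_divide_distrib power_one_over)

lemma standardized_indep:
  assumes "I \<subseteq> modes J \<times> UNIV"
  shows "indep_vars (\<lambda>_. borel) (\<lambda>k \<omega>. (E (fst k) \<omega> $ snd k - c (fst k) $ snd k) / s (fst k)) I"
  using indep_vars_compose2[OF indep_vars_subset[OF indep assms], of "\<lambda>k x. (x - c (fst k) $ snd k) / s (fst k)" "\<lambda>_. borel"]
  by (simp add: split_beta)

end

text \<open>A coordinate with \<open>s = 0\<close> is almost surely constant, so any standard Gaussian multiplied by \<open>s\<close>
  represents its deviation from the mean; taking a fresh one for each such coordinate from the second
  factor keeps the whole family independent.\<close>

lemma standard_gaussian_extension: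
  fixes E :: "bool \<times> nat \<Rightarrow> 'w \<Rightarrow> real ^ 'n"
  assumes "gaussian_trig_sum M J E c v" and v: "\<And>m. m \<in> modes J \<Longrightarrow> v (snd m) = (s m)\<^sup>2"
  obtains P :: "(nat \<Rightarrow> real) measure" and S where "prob_space P"
    "prob_space.indep_vars (M \<Otimes>\<^sub>M P) (\<lambda>_. borel) S (modes J \<times> UNIV)"
    "\<And>k. k \<in> modes J \<times> UNIV \<Longrightarrow> distr (M \<Otimes>\<^sub>M P) borel (S k) = std_normal_distribution"
    "\<And>m i. m \<in> modes J \<Longrightarrow> AE \<omega> in M \<Otimes>\<^sub>M P. E m (fst \<omega>) $ i - c m $ i = s m * S (m, i) \<omega>"
proof -
  interpret gaussian_trig_sum M J E c v by fact
  obtain P :: "(nat \<Rightarrow> real) measure" where P: "prob_space P"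
    and xi: "prob_space.indep_vars P (\<lambda>_. borel) (\<lambda>i x. x i) UNIV"
      "\<And>i. distr P borel (\<lambda>x. x i) = std_normal_distribution"
    using exists_standard_gaussian_sequence by blast
  interpret P: prob_space P by fact
  define K where "K = modes J \<times> (UNIV :: 'n set)"
  define I where "I = {k \<in> K. s (fst k) \<noteq> 0}"
  obtain e :: "(bool \<times> nat) \<times> 'n \<Rightarrow> nat" where e: "inj_on e K"
    using finite_imp_inj_to_nat_seg[of K] by (auto simp: K_def)
  \<comment> \<open>\<open>I\<close> collects the coordinates that can be standardized, and \<open>e\<close> numbers all of them, which assigns a fresh variable to each of the others.\<close>
  define U where "U k \<omega> = (E (fst k) \<omega> $ snd k - c (fst k) $ snd k) / s (fst k)" for k \<omega>
  define S where "S = (\<lambda>k \<omega>. if k \<in> I then U k (fst \<omega>) else snd \<omega> (e k))"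
  have I: "I \<subseteq> K" by (auto simp: I_def)
  have U_indep: "indep_vars (\<lambda>_. borel) U I"
    unfolding U_def[abs_def] by (rule standardized_indep) (use I in \<open>simp add: K_def\<close>)
  then have [measurable]: "k \<in> I \<Longrightarrow> U k \<in> borel_measurable M" for k
    by (simp add: indep_vars_def2)
  have [measurable]: "(\<lambda>x. x i) \<in> borel_measurable P" for i
    using xi(1) by (simp add: P.indep_vars_def2)
  have U_std: "distr M borel (U k) = std_normal_distribution" if "k \<in> I" for k
    using that unfolding U_def[abs_def]
    by (intro distr_standard_gaussian standardized_coord v) (auto simp: I_def K_def)
  have fst_eq: "distr (M \<Otimes>\<^sub>M P) M fst = M" by (rule P.distr_pair_fst)
  have snd_eq: "distr (M \<Otimes>\<^sub>M P) P snd = P" by (rule distr_pair_snd[OF prob_space_axioms P])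
  have "prob_space.indep_vars (M \<Otimes>\<^sub>M P) (\<lambda>_. borel) S (I \<union> (K - I))"
    unfolding S_def
    by (intro indep_vars_pair_measure prob_space_axioms P U_indep P.indep_vars_inj[OF xi(1)])
       (use e in \<open>auto intro: inj_on_subset\<close>)
  then have 1: "prob_space.indep_vars (M \<Otimes>\<^sub>M P) (\<lambda>_. borel) S (modes J \<times> UNIV)"
    using I by (simp add: K_def Un_absorb1)
  have 2: "distr (M \<Otimes>\<^sub>M P) borel (S k) = std_normal_distribution" for k
  proof (cases "k \<in> I")
    case True
    have "distr (M \<Otimes>\<^sub>M P) borel (\<lambda>\<omega>. U k (fst \<omega>)) = distr (distr (M \<Otimes>\<^sub>M P) M fst) borel (U k)"
      using True by (subst distr_distr) (auto simp: o_def)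
    with True show ?thesis by (simp add: S_def fst_eq U_std)
  next
    case False
    have "distr (M \<Otimes>\<^sub>M P) borel (\<lambda>\<omega>. snd \<omega> (e k)) = distr (distr (M \<Otimes>\<^sub>M P) P snd) borel (\<lambda>x. x (e k))"
      by (subst distr_distr) (auto simp: o_def)
    with False show ?thesis by (simp add: S_def snd_eq xi(2))
  qed
  have 3: "AE \<omega> in M \<Otimes>\<^sub>M P. E m (fst \<omega>) $ i - c m $ i = s m * S (m, i) \<omega>" if m: "m \<in> modes J" for m i
  proof (cases "s m = 0")
    case True
    then have "AE \<omega> in M. E m \<omega> $ i = c m $ i"
      using gaussian[OF m, of i] v[OF m] by (simp add: gaussian_rv_def)
    then have "AE \<omega> in distr (M \<Otimes>\<^sub>M P) M fst. E m \<omega> $ i = c m $ i"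
      by (simp only: fst_eq)
    from AE_distrD[OF measurable_fst this] show ?thesis by eventually_elim (simp add: True)
  next
    case False
    then show ?thesis using m by (auto simp: S_def I_def K_def U_def)
  qed
  show ?thesis by (rule that[OF P 1 2 3])
qed

section \<open>The law of the estimator and its error\<close>

theorem theorem1:
  fixes M :: "'w measure"
    and T J :: nat
    and \<Gamma> :: "real \<Rightarrow> real ^ 2"
    and \<sigma> :: "nat \<Rightarrow> real"
    and A B :: "nat \<Rightarrow> nat \<Rightarrow> 2 \<Rightarrow> 'w \<Rightarrow> real"
    and N X :: "nat \<Rightarrow> real \<Rightarrow> 'w \<Rightarrow> real ^ 2"
  assumes "prob_space M"
    and "J \<ge> 1"
    and "C1_curve \<Gamma>" and "\<Gamma> (-pi) = \<Gamma> pi"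
    and "noise_model M T \<sigma> A B N"
    and "\<And>t \<theta> \<omega>. t \<le> T \<Longrightarrow> \<theta> \<in> {-pi..pi} \<Longrightarrow> \<omega> \<in> space M \<Longrightarrow> X t \<theta> \<omega> = \<Gamma> \<theta> + N t \<theta> \<omega>"
  shows "gaussian_process M {-pi..pi} (Gamma_hat T J X) \<and>
         covariance_stationary M {-pi..pi} (Gamma_hat T J X) \<and>
         cyclic_process M (Gamma_hat T J X) \<and>
         independent_components M {-pi..pi} (Gamma_hat T J X) \<and>
         (\<forall>\<theta>\<in>{-pi..pi}. (LINT \<omega>|M. Gamma_hat T J X \<theta> \<omega>) =
              trig_poly J (fourier_cos \<Gamma>) (fourier_sin \<Gamma>) \<theta>) \<and>
         (\<forall>\<theta>\<in>{-pi..pi}. \<forall>\<eta>\<in>{-pi..pi}. \<forall>i.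
              covariance M (\<lambda>\<omega>. Gamma_hat T J X \<theta> \<omega> $ i) (\<lambda>\<omega>. Gamma_hat T J X \<eta> \<omega> $ i) =
              rho \<sigma> J (\<eta> - \<theta>) / real (T + 1)) \<and>
         summable (\<lambda>j. (norm (fourier_cos \<Gamma> j))\<^sup>2 + (norm (fourier_sin \<Gamma> j))\<^sup>2) \<and>
         ((\<forall>j\<le>J. \<sigma> j \<noteq> 0) \<longrightarrow>
              (\<exists>Z\<^sub>J. weighted_chi_square_sum M T J \<sigma> Z\<^sub>J \<and>
                (AE \<omega> in M. integrated_squared_error (\<lambda>\<theta>. Gamma_hat T J X \<theta> \<omega>) \<Gamma> =
                  (\<Sum>j. (norm (fourier_cos \<Gamma> (j + (J + 1))))\<^sup>2 +
                        (norm (fourier_sin \<Gamma> (j + (J + 1))))\<^sup>2) + Z\<^sub>J \<omega>))) \<and>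
         (\<exists>(P :: (nat \<Rightarrow> real) measure) Z\<^sub>J. prob_space P \<and>
              weighted_chi_square_sum (M \<Otimes>\<^sub>M P) T J \<sigma> Z\<^sub>J \<and>
              (AE \<omega> in M \<Otimes>\<^sub>M P.
                integrated_squared_error (\<lambda>\<theta>. Gamma_hat T J X \<theta> (fst \<omega>)) \<Gamma> =
                  (\<Sum>j. (norm (fourier_cos \<Gamma> (j + (J + 1))))\<^sup>2 +
                        (norm (fourier_sin \<Gamma> (j + (J + 1))))\<^sup>2) + Z\<^sub>J \<omega>))"
proof -
  let ?E = "mean_fcoef T X" and ?v = "\<lambda>j. (\<sigma> j)\<^sup>2 / real (T + 1)"
  let ?tail = "\<Sum>j. (norm (fourier_cos \<Gamma> (j + (J + 1))))\<^sup>2 + (norm (fourier_sin \<Gamma> (j + (J + 1))))\<^sup>2"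
  define s where "s m = \<sigma> (snd m) / sqrt (real (T + 1))" for m :: "bool \<times> nat"
  have s: "?v (snd m) = (s m)\<^sup>2" for m
    by (simp add: s_def power_divide)
  interpret prob_space M by fact
  have \<Gamma>: "continuous_on {-pi..pi} \<Gamma>" by (rule C1_curve_continuous) fact
  have G: "gaussian_trig_sum M J ?E (fcoef \<Gamma>) ?v"
    using mean_fcoef_independent_gaussian[OF assms(1) \<Gamma> assms(5,6)]
    by unfold_locales auto
  interpret gaussian_trig_sum M J ?E "fcoef \<Gamma>" ?v by fact
  have process_eq: "Gamma_hat T J X = process"
    by (intro ext) (simp add: Gamma_hat_eq_trig_sum process_def)
  note tail = integrated_squared_error_trig_sum[OF \<Gamma> assms(4), where J = J]
  \<comment> \<open>Parseval's identity holds for each outcome separately; stated in this way it serves the original space and its enlargement alike.\<close>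
  have ISE: "integrated_squared_error (\<lambda>\<theta>. Gamma_hat T J X \<theta> \<omega>) \<Gamma> =
      ?tail + (\<Sum>m\<in>modes J. mode_weight m * ((\<sigma> (snd m))\<^sup>2 / real (T + 1) * (\<Sum>i\<in>UNIV. (S (m, i))\<^sup>2)))"
    if S: "\<And>m i. m \<in> modes J \<Longrightarrow> ?E m \<omega> $ i - fcoef \<Gamma> m $ i = s m * S (m, i)" for \<omega> S
  proof -
    have "(norm (?E m \<omega> - fcoef \<Gamma> m))\<^sup>2 = ?v (snd m) * (\<Sum>i\<in>UNIV. (S (m, i))\<^sup>2)" if "m \<in> modes J" for m
      unfolding power2_norm_eq_inner inner_vec_def s
      by (simp add: S[OF that] sum_distrib_left power2_eq_square mult_ac)
    then show ?thesis
      using sums_unique[OF tail[of "\<lambda>m. ?E m \<omega>"]] by (simp add: Gamma_hat_eq_trig_sum)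
  qed
  have mean: "(LINT \<omega>|M. Gamma_hat T J X \<theta> \<omega>) = trig_poly J (fourier_cos \<Gamma>) (fourier_sin \<Gamma>) \<theta>" for \<theta>
    using expectation_process[of \<theta>] by (simp add: process_eq trig_poly_fourier)
  have cov: "covariance M (\<lambda>\<omega>. Gamma_hat T J X \<theta> \<omega> $ i) (\<lambda>\<omega>. Gamma_hat T J X \<eta> \<omega> $ i) =
      rho \<sigma> J (\<eta> - \<theta>) / real (T + 1)" for \<theta> \<eta> i
    by (simp add: process_eq covariance_process rho_def sum_divide_distrib)
  have square_summable: "summable (\<lambda>j. (norm (fourier_cos \<Gamma> j))\<^sup>2 + (norm (fourier_sin \<Gamma> j))\<^sup>2)"
    by (rule summable_iff_shift[THEN iffD1, of _ "J + 1"]) (rule sums_summable[OF tail])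
  have nondegenerate: "\<exists>Z. weighted_chi_square_sum M T J \<sigma> Z \<and>
      (AE \<omega> in M. integrated_squared_error (\<lambda>\<theta>. Gamma_hat T J X \<theta> \<omega>) \<Gamma> = ?tail + Z \<omega>)"
    if "\<forall>j\<le>J. \<sigma> j \<noteq> 0"
  proof -
    define S where "S k \<omega> = (?E (fst k) \<omega> $ snd k - fcoef \<Gamma> (fst k) $ snd k) / s (fst k)" for k :: "(bool \<times> nat) \<times> 2" and \<omega>
    have s0: "s m \<noteq> 0" if "m \<in> modes J" for m
      using that \<open>\<forall>j\<le>J. \<sigma> j \<noteq> 0\<close> by (auto simp: s_def mem_modes_iff)
    have "weighted_chi_square_sum M T J \<sigma>
       (\<lambda>\<omega>. \<Sum>m\<in>modes J. mode_weight m * ((\<sigma> (snd m))\<^sup>2 / real (T + 1) * (\<Sum>i\<in>UNIV. (S (m, i) \<omega>)\<^sup>2)))"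
    proof (rule weighted_chi_square_sum_standard_gaussian)
      show "indep_vars (\<lambda>_. borel) S (modes J \<times> UNIV)"
        unfolding S_def[abs_def] by (rule standardized_indep) simp
      show "distr M borel (S k) = std_normal_distribution" if "k \<in> modes J \<times> UNIV" for k
        using that s0 unfolding S_def[abs_def]
        by (intro distr_standard_gaussian standardized_coord s) auto
    qed
    moreover have "integrated_squared_error (\<lambda>\<theta>. Gamma_hat T J X \<theta> \<omega>) \<Gamma> = ?tail +
        (\<Sum>m\<in>modes J. mode_weight m * ((\<sigma> (snd m))\<^sup>2 / real (T + 1) * (\<Sum>i\<in>UNIV. (S (m, i) \<omega>)\<^sup>2)))" for \<omega>
      by (rule ISE) (simp add: S_def s0)
    ultimately show ?thesis by (intro exI conjI) auto
  qed
  have extended: "\<exists>(P :: (nat \<Rightarrow> real) measure) Z. prob_space P \<and> weighted_chi_square_sum (M \<Otimes>\<^sub>M P) T J \<sigma> Z \<and>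
      (AE \<omega> in M \<Otimes>\<^sub>M P. integrated_squared_error (\<lambda>\<theta>. Gamma_hat T J X \<theta> (fst \<omega>)) \<Gamma> = ?tail + Z \<omega>)"
  proof -
    obtain P :: "(nat \<Rightarrow> real) measure" and S where P: "prob_space P"
      and S: "prob_space.indep_vars (M \<Otimes>\<^sub>M P) (\<lambda>_. borel) S (modes J \<times> UNIV)"
        "\<And>k. k \<in> modes J \<times> UNIV \<Longrightarrow> distr (M \<Otimes>\<^sub>M P) borel (S k) = std_normal_distribution"
        "\<And>m i. m \<in> modes J \<Longrightarrow> AE \<omega> in M \<Otimes>\<^sub>M P. ?E m (fst \<omega>) $ i - fcoef \<Gamma> m $ i = s m * S (m, i) \<omega>"
      using standard_gaussian_extension[OF G, of s] s by blast
    interpret MP: prob_space "M \<Otimes>\<^sub>M P" by (rule prob_space_pair[OF assms(1) P])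
    have "AE \<omega> in M \<Otimes>\<^sub>M P. \<forall>m\<in>modes J. \<forall>i\<in>UNIV. ?E m (fst \<omega>) $ i - fcoef \<Gamma> m $ i = s m * S (m, i) \<omega>"
      by (intro AE_finite_allI S(3)) auto
    then have "AE \<omega> in M \<Otimes>\<^sub>M P. integrated_squared_error (\<lambda>\<theta>. Gamma_hat T J X \<theta> (fst \<omega>)) \<Gamma> = ?tail +
        (\<Sum>m\<in>modes J. mode_weight m * ((\<sigma> (snd m))\<^sup>2 / real (T + 1) * (\<Sum>i\<in>UNIV. (S (m, i) \<omega>)\<^sup>2)))"
      by eventually_elim (rule ISE, simp)
    with P MP.weighted_chi_square_sum_standard_gaussian[OF S(1,2)] show ?thesis by blast
  qed
  show ?thesis
    using mean cov square_summable nondegenerate extended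
      process_is_gaussian process_is_covariance_stationary process_is_cyclic process_has_independent_components
    unfolding process_eq[symmetric] by blast
qed

end
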